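(* Let $\mathbb{K}=\mathbb{R}$ or $\mathbb{C}$. Let $X$ be a $\mathbb{K}$-analytic subspace of $\mathbb{K}^m$, of dimension $m-k$ at $0\in X$. Suppose that the local ring $\mathcal{O}_{X,0}=\mathbb{K}\{x\}/I$ is a complete intersection, and that $\{f_1,\dots,f_k\}$ is a regular sequence in $\mathbb{K}\{x\}$ which generates the ideal $I$. Then there exists $\mu_0\in\mathbb{N}$ such that, for every $\mu\geq\mu_0$ and for every $k$-tuple $\{g_1,\dots,g_k\}\subset\mathbb{K}\{x\}$ satisfying $j^\mu g_i=j^\mu f_i$ for $i=1,\dots,k$, we have: (i) the $k$-tuple $\{g_1,\dots,g_k\}$ is a regular sequence in $\mathbb{K}\{x\}$; (ii) the ideal $J:=(g_1,\dots,g_k)\cdot\mathbb{K}\{x\}$ satisfies $H_J(\eta)=H_I(\eta)$ for all $\eta\in\mathbb{N}$.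
   Context: Here $x=(x_1,\dots,x_m)$, $\mathbb{K}\{x\}$ is the ring of convergent power series in $x$ with coefficients in $\mathbb{K}$, and $\mathfrak{m}_x$ is its maximal ideal; $\mathbb{N}$ contains $0$. For $\mu\in\mathbb{N}$ and $f\in\mathbb{K}\{x\}$, the $\mu$-jet $j^\mu f$ is the image of $f$ under the canonical epimorphism $\mathbb{K}\{x\}\to\mathbb{K}\{x\}/\mathfrak{m}_x^{\mu+1}$ (so $j^\mu g=j^\mu f$ means $g-f\in\mathfrak{m}_x^{\mu+1}$). For an ideal $J$ in $\mathbb{K}\{x\}$, the Hilbert-Samuel function of $\mathbb{K}\{x\}/J$ is $H_J(\eta)=\dim_{\mathbb{K}}\mathbb{K}\{x\}/(J+\mathfrak{m}_x^{\eta+1})$, $\eta\in\mathbb{N}$. A sequence $a_1,\dots,a_k$ in a ring $A$ is a regular sequence if the ideal $(a_1,\dots,a_k)$ is proper, $a_1$ is a non-zerodivisor in $A$ and, for each $i=1,\dots,k-1$, the image of $a_{i+1}$ is a non-zerodivisor in $A/(a_1,\dots,a_i)$. A ring $R$ is a complete intersection if $R\cong A/(a_1,\dots,a_k)$ for some regular ring $A$ and some regular sequence $a_1,\dots,a_k$ in $A$. *)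

theory Defs
  imports
    "HOL-Algebra.Embedded_Algebras"
    "HOL-Algebra.QuotRing"
    "HOL-Algebra.Ideal_Product"
    "HOL-Algebra.Ring_Divisibility"
    "HOL-Analysis.Infinite_Sum"
    "HOL-Analysis.Function_Topology"
    "HOL-Library.Poly_Mapping"
    "HOL-Library.Extended_Nat"
begin

section \<open>Commutative algebra\<close>

definition non_zerodivisor :: "('a, 'b) ring_scheme \<Rightarrow> 'a \<Rightarrow> bool" where
  "non_zerodivisor R a \<longleftrightarrow>
     a \<in> carrier R \<and> (\<forall>b\<in>carrier R. a \<otimes>\<^bsub>R\<^esub> b = \<zero>\<^bsub>R\<^esub> \<longrightarrow> b = \<zero>\<^bsub>R\<^esub>)"

definition regular_sequence :: "('a, 'b) ring_scheme \<Rightarrow> 'a list \<Rightarrow> bool" where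
  "regular_sequence A as \<longleftrightarrow>
     set as \<subseteq> carrier A \<and>
     Idl\<^bsub>A\<^esub> (set as) \<noteq> carrier A \<and>
     (as \<noteq> [] \<longrightarrow> non_zerodivisor A (as ! 0)) \<and>
     (\<forall>i. 0 < i \<and> i < length as \<longrightarrow>
        non_zerodivisor (A Quot (Idl\<^bsub>A\<^esub> (set (take i as))))
          (Idl\<^bsub>A\<^esub> (set (take i as)) +>\<^bsub>A\<^esub> (as ! i)))"

definition krull_dim :: "('a, 'b) ring_scheme \<Rightarrow> enat" where
  "krull_dim R =
     (SUP n \<in> {n. \<exists>P. (\<forall>i\<le>n. primeideal (P i) R) \<and> (\<forall>i<n. P i \<subset> P (Suc i))}. enat n)"

text \<open>The fraction \<open>a / s\<close> is the class of \<open>(a, s)\<close> for the relation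
  \<open>u (t a - s b) = 0\<close> for some \<open>u \<in> S\<close>. As for the product of cosets in the quotient
  ring of the library, the operations are written as unions over all representatives, all of
  which contribute the same class.\<close>

definition fraction :: "('a, 'b) ring_scheme \<Rightarrow> 'a set \<Rightarrow> 'a \<Rightarrow> 'a \<Rightarrow> ('a \<times> 'a) set" where
  "fraction R S a s =
     {(b, t). b \<in> carrier R \<and> t \<in> S \<and>
        (\<exists>u\<in>S. u \<otimes>\<^bsub>R\<^esub> ((t \<otimes>\<^bsub>R\<^esub> a) \<ominus>\<^bsub>R\<^esub> (s \<otimes>\<^bsub>R\<^esub> b)) = \<zero>\<^bsub>R\<^esub>)}"

definition localization :: "('a, 'b) ring_scheme \<Rightarrow> 'a set \<Rightarrow> ('a \<times> 'a) set ring" where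
  "localization R S =
     \<lparr>carrier = {fraction R S a s | a s. a \<in> carrier R \<and> s \<in> S},
      monoid.mult = (\<lambda>X Y. \<Union>(a, s)\<in>X. \<Union>(b, t)\<in>Y. fraction R S (a \<otimes>\<^bsub>R\<^esub> b) (s \<otimes>\<^bsub>R\<^esub> t)),
      one = fraction R S \<one>\<^bsub>R\<^esub> \<one>\<^bsub>R\<^esub>,
      zero = fraction R S \<zero>\<^bsub>R\<^esub> \<one>\<^bsub>R\<^esub>,
      add = (\<lambda>X Y. \<Union>(a, s)\<in>X. \<Union>(b, t)\<in>Y.
               fraction R S ((a \<otimes>\<^bsub>R\<^esub> t) \<oplus>\<^bsub>R\<^esub> (b \<otimes>\<^bsub>R\<^esub> s)) (s \<otimes>\<^bsub>R\<^esub> t))\<rparr>"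

definition regular_local_ring :: "('a, 'b) ring_scheme \<Rightarrow> bool" where
  "regular_local_ring R \<longleftrightarrow>
     cring R \<and> noetherian_ring R \<and>
     (\<exists>M. (\<forall>N. maximalideal N R \<longleftrightarrow> N = M) \<and>
          (\<exists>S\<subseteq>carrier R. finite S \<and> Idl\<^bsub>R\<^esub> S = M \<and> enat (card S) = krull_dim R))"

definition regular_ring :: "('a, 'b) ring_scheme \<Rightarrow> bool" where
  "regular_ring R \<longleftrightarrow>
     cring R \<and> noetherian_ring R \<and>
     (\<forall>P. primeideal P R \<longrightarrow> regular_local_ring (localization R (carrier R - P)))"

text \<open>HOL cannot quantify over the type of the elements of the regular ring \<open>A\<close> inside a
  formula, so that type is a parameter. As a premise with a free type parameter the notion means
  that such an \<open>A\<close> exists over some type.\<close>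

definition complete_intersection :: "'c itself \<Rightarrow> ('a, 'b) ring_scheme \<Rightarrow> bool" where
  "complete_intersection (_ :: 'c itself) R \<longleftrightarrow>
     (\<exists>(A :: 'c ring) as. regular_ring A \<and> regular_sequence A as \<and>
        R \<simeq> A Quot (Idl\<^bsub>A\<^esub> (set as)))"

primrec ideal_power :: "('a, 'b) ring_scheme \<Rightarrow> 'a set \<Rightarrow> nat \<Rightarrow> 'a set" where
  "ideal_power R I 0 = carrier R"
| "ideal_power R I (Suc n) = ideal_prod R I (ideal_power R I n)"


section \<open>Convergent power series\<close>

text \<open>The ground field ranges over the class of complete real normed fields with multiplicative
  norm. It has the instances \<open>real\<close> and \<open>complex\<close>, and no others up to isomorphism, by the
  theorem of Gelfand and Mazur.

  A multi-index in \<open>\<nat>\<^sup>m\<close> is a finitely supported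
  function with support in \<open>{..<m}\<close>, and, as in \<open>Euclidean_space\<close> of the library, a point of
  \<open>K\<^sup>m\<close> is a sequence vanishing from position \<open>m\<close> on. A power series is its family of
  coefficients.\<close>

type_synonym 'a pseries = "(nat \<Rightarrow>\<^sub>0 nat) \<Rightarrow> 'a"

definition multi_indices :: "nat \<Rightarrow> (nat \<Rightarrow>\<^sub>0 nat) set" where
  "multi_indices m = {\<alpha>. Poly_Mapping.keys \<alpha> \<subseteq> {..<m}}"

definition affine_space :: "nat \<Rightarrow> (nat \<Rightarrow> 'a::zero) set" where
  "affine_space m = {p. \<forall>i\<ge>m. p i = 0}"

definition monomial_at :: "(nat \<Rightarrow> 'a::comm_monoid_mult) \<Rightarrow> (nat \<Rightarrow>\<^sub>0 nat) \<Rightarrow> 'a" where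
  "monomial_at p \<alpha> = (\<Prod>i\<in>Poly_Mapping.keys \<alpha>. p i ^ Poly_Mapping.lookup \<alpha> i)"

definition polydisc :: "nat \<Rightarrow> real \<Rightarrow> (nat \<Rightarrow> 'a::real_normed_field) set" where
  "polydisc m r = {p \<in> affine_space m. \<forall>i<m. norm (p i) < r}"

definition convergent_pseries :: "nat \<Rightarrow> 'a::{real_normed_field,banach} pseries \<Rightarrow> bool" where
  "convergent_pseries m f \<longleftrightarrow>
     (\<forall>\<alpha>. \<alpha> \<notin> multi_indices m \<longrightarrow> f \<alpha> = 0) \<and>
     (\<exists>r>0. \<forall>p\<in>polydisc m r. (\<lambda>\<alpha>. f \<alpha> * monomial_at p \<alpha>) abs_summable_on multi_indices m)"

definition const_pseries :: "'a::zero \<Rightarrow> 'a pseries" where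
  "const_pseries c = (\<lambda>\<alpha>. if \<alpha> = 0 then c else 0)"

definition cps :: "nat \<Rightarrow> 'a::{real_normed_field,banach} pseries ring" where
  "cps m =
     \<lparr>carrier = {f. convergent_pseries m f},
      monoid.mult = (\<lambda>f g \<alpha>. \<Sum>(\<beta>, \<gamma>) | \<beta> + \<gamma> = \<alpha>. f \<beta> * g \<gamma>),
      one = const_pseries 1,
      zero = const_pseries 0,
      add = (\<lambda>f g \<alpha>. f \<alpha> + g \<alpha>)\<rparr>"

definition max_ideal :: "nat \<Rightarrow> 'a::{real_normed_field,banach} pseries set" where
  "max_ideal m = {f \<in> carrier (cps m). f 0 = 0}"

definition jet :: "nat \<Rightarrow> nat \<Rightarrow> 'a::{real_normed_field,banach} pseries \<Rightarrow> 'a pseries set" where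
  "jet m \<mu> f = ideal_power (cps m) (max_ideal m) (\<mu> + 1) +>\<^bsub>cps m\<^esub> f"

text \<open>The dimension is taken over the copy of \<open>K\<close> in the quotient, i.e. the classes of the
  constants.\<close>

definition hilbert_samuel ::
    "nat \<Rightarrow> 'a::{real_normed_field,banach} pseries set \<Rightarrow> nat \<Rightarrow> nat" where
  "hilbert_samuel m J \<eta> =
     (let L = J <+>\<^bsub>cps m\<^esub> ideal_power (cps m) (max_ideal m) (\<eta> + 1);
          Q = cps m Quot L
      in ring.dim Q (range (\<lambda>c. L +>\<^bsub>cps m\<^esub> const_pseries c)) (carrier Q))"


section \<open>Analytic subspaces\<close>

text \<open>\<open>f\<close> is the germ at \<open>\<xi>\<close> of the function \<open>h\<close>: its expansion in the coordinates
  centred at \<open>\<xi>\<close>.\<close>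

definition is_germ ::
    "nat \<Rightarrow> ((nat \<Rightarrow> 'a::{real_normed_field,banach}) \<Rightarrow> 'a) \<Rightarrow> (nat \<Rightarrow> 'a) \<Rightarrow> 'a pseries \<Rightarrow> bool"
  where
  "is_germ m h \<xi> f \<longleftrightarrow>
     f \<in> carrier (cps m) \<and>
     (\<exists>r>0. \<forall>p\<in>polydisc m r.
        ((\<lambda>\<alpha>. f \<alpha> * monomial_at p \<alpha>) has_sum h (\<lambda>i. \<xi> i + p i)) (multi_indices m))"

text \<open>An analytic subspace of \<open>K\<^sup>m\<close> is a closed analytic subspace of an open set \<open>U\<close>, given by
  an ideal sheaf on \<open>U\<close> that is locally generated by finitely many analytic functions. A sheaf
  of ideals is determined by its stalks, and \<open>\<I> \<xi>\<close> is the stalk at \<open>\<xi>\<close>, expressed in the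
  coordinates centred at \<open>\<xi>\<close>.\<close>

definition analytic_subspace ::
    "nat \<Rightarrow> (nat \<Rightarrow> 'a::{real_normed_field,banach}) set \<Rightarrow> ((nat \<Rightarrow> 'a) \<Rightarrow> 'a pseries set) \<Rightarrow> bool"
  where
  "analytic_subspace m U \<I> \<longleftrightarrow>
     openin (top_of_set (affine_space m)) U \<and>
     (\<forall>\<xi>\<in>U. \<exists>V H. openin (top_of_set (affine_space m)) V \<and> \<xi> \<in> V \<and> V \<subseteq> U \<and>
        finite H \<and> (\<forall>h\<in>H. \<forall>\<zeta>\<in>V. \<exists>f. is_germ m h \<zeta> f) \<and>
        (\<forall>\<zeta>\<in>V. \<I> \<zeta> = Idl\<^bsub>cps m\<^esub> {f. \<exists>h\<in>H. is_germ m h \<zeta> f}))"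

definition points ::
    "nat \<Rightarrow> (nat \<Rightarrow> 'a::{real_normed_field,banach}) set \<Rightarrow> ((nat \<Rightarrow> 'a) \<Rightarrow> 'a pseries set) \<Rightarrow> (nat \<Rightarrow> 'a) set"
  where
  "points m U \<I> = {\<xi> \<in> U. \<I> \<xi> \<noteq> carrier (cps m)}"

definition local_ring ::
    "nat \<Rightarrow> ((nat \<Rightarrow> 'a::{real_normed_field,banach}) \<Rightarrow> 'a pseries set) \<Rightarrow> (nat \<Rightarrow> 'a) \<Rightarrow> 'a pseries set ring"
  where
  "local_ring m \<I> \<xi> = cps m Quot (\<I> \<xi>)"

text \<open>The dimension of an analytic space at a point is the Krull dimension of its local ring
  (over the reals it can exceed the dimension of the germ of the underlying point set).\<close>

definition dim_at ::
    "nat \<Rightarrow> ((nat \<Rightarrow> 'a::{real_normed_field,banach}) \<Rightarrow> 'a pseries set) \<Rightarrow> (nat \<Rightarrow> 'a) \<Rightarrow> enat"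
  where
  "dim_at m \<I> \<xi> = krull_dim (local_ring m \<I> \<xi>)"

end

theory Submission
  imports Defs
begin

text \<open>Let \<open>I\<^sub>i\<close> and \<open>J\<^sub>i\<close> be the ideals generated by the first \<open>i\<close> of the series \<open>f\<^sub>1, f\<^sub>2, \<dots>\<close> and
  \<open>g\<^sub>1, g\<^sub>2, \<dots>\<close>. The heart of the matter is an Artin-Rees property whose constant \<open>c\<close> is the same for
  all \<open>g\<close> with the same \<open>\<mu>\<close>-jets as \<open>f\<close>: an element of \<open>J\<^sub>i\<close> of order at least \<open>N\<close> is a combination of
  \<open>g\<^sub>1, \<dots>, g\<^sub>i\<close> with coefficients of order at least \<open>N - c\<close>. Replacing each \<open>g\<^sub>l\<close> by \<open>f\<^sub>l\<close> in such a
  combination changes an element of order \<open>e\<close> only by terms of order at least \<open>e - c + \<mu> + 1\<close>, which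
  is more than \<open>e\<close> once \<open>\<mu> \<ge> c\<close> (lemma \<open>artin_rees_transport\<close>). As \<open>f\<close> is one of the admitted \<open>g\<close>, it
  follows that \<open>I\<^sub>i\<close> and \<open>J\<^sub>i\<close> have the same initial forms, hence the same leading exponents for every
  monomial order that compares degrees first. The Hilbert-Samuel function at \<open>\<eta>\<close> is the number of
  monomials of degree at most \<open>\<eta>\<close> that are not leading (\<open>hilbert_samuel_eq_card\<close>), so it is the same for
  both ideals; and \<open>J\<^sub>k\<close> is proper because \<open>1\<close> would have the leading exponent \<open>0\<close>.

  The uniform property is proved by induction on \<open>i\<close>, together with the regularity of \<open>g\<close>
  (\<open>regular_perturbation\<close>). The Artin-Rees property of the fixed ideal \<open>I\<^sub>i\<^sub>+\<^sub>1\<close>, with a constant \<open>c\<^sub>1\<close>,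
  and the regularity of \<open>f\<close> show: if \<open>f\<^sub>i\<^sub>+\<^sub>1 b\<close> is in \<open>I\<^sub>i\<close> up to order \<open>n + c\<^sub>1\<close>, then \<open>b\<close> is in \<open>I\<^sub>i\<close> up
  to order \<open>n\<close>. This passes to \<open>g\<close> with \<open>c\<^sub>1 + 1\<close> in place of \<open>c\<^sub>1\<close>. Suppose that \<open>b\<close> is in \<open>J\<^sub>i\<close> up to
  order \<open>e < n\<close>, so that one may take \<open>b\<close> of order at least \<open>e\<close>. Comparing \<open>g\<^sub>i\<^sub>+\<^sub>1 b\<close> with \<open>f\<^sub>i\<^sub>+\<^sub>1 b\<close>
  and \<open>J\<^sub>i\<close> with \<open>I\<^sub>i\<close> shows, for \<open>\<mu> \<ge> c + c\<^sub>1\<close>, that \<open>f\<^sub>i\<^sub>+\<^sub>1 b\<close> is in \<open>I\<^sub>i\<close> up to order \<open>e + 1 + c\<^sub>1\<close>, so \<open>b\<close> is in \<open>I\<^sub>i\<close>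
  up to order \<open>e + 1\<close>, and then in \<open>J\<^sub>i\<close> up to order \<open>e + 1\<close> because the initial forms agree. In this
  way \<open>e\<close> climbs to \<open>n\<close>. With \<open>n\<close> arbitrary this makes \<open>g\<^sub>i\<^sub>+\<^sub>1\<close> a non-zerodivisor modulo the closure
  of \<open>J\<^sub>i\<close>, which is \<open>J\<^sub>i\<close>; with \<open>n\<close> fixed it bounds the order of the last coefficient of an element of
  \<open>J\<^sub>i\<^sub>+\<^sub>1\<close>, and the induction hypothesis bounds the others.

  What this uses about convergent power series is that ideals are closed in the topology given by
  the order of vanishing and that a fixed ideal has the Artin-Rees property. Both follow
  (\<open>ideal_finite_generation\<close>) from division with remainder by a standard basis, in the style of Grauert
  and Hironaka (\<open>division\<close>). The quotients and the remainder are read off from one series that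
  satisfies a linear recursion along the monomial order, and a bound for its coefficients is proved
  by induction along the same order, for a polyradius at which the leading monomials of the
  divisors dominate (\<open>common_weight\<close>).

  Most of the work is done in a type of formal power series with a predicate for convergence.
  The results are carried over to the ring \<open>cps m\<close> at the end.\<close>

section \<open>Multi-indices\<close>

alias lookup = Poly_Mapping.lookup
alias keys = Poly_Mapping.keys

definition deg :: "nat \<Rightarrow> (nat \<Rightarrow>\<^sub>0 nat) \<Rightarrow> nat" where
  "deg m \<alpha> = (\<Sum>i<m. lookup \<alpha> i)"

lemma deg_add [simp]: "deg m (\<alpha> + \<beta>) = deg m \<alpha> + deg m \<beta>"
  by (simp add: deg_def lookup_add sum.distrib)

lemma deg_zero [simp]: "deg m 0 = 0"
  by (simp add: deg_def)

lemma lookup_le_deg: "i < m \<Longrightarrow> lookup \<alpha> i \<le> deg m \<alpha>"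
  unfolding deg_def by (rule member_le_sum) auto

lemma multi_indicesI: "(\<And>i. i \<ge> m \<Longrightarrow> lookup \<alpha> i = 0) \<Longrightarrow> \<alpha> \<in> multi_indices m"
  unfolding multi_indices_def by (rule CollectI, rule subsetI, rule ccontr) (simp add: in_keys_iff)

lemma multi_indicesD: "\<alpha> \<in> multi_indices m \<Longrightarrow> i \<ge> m \<Longrightarrow> lookup \<alpha> i = 0"
  by (force simp: multi_indices_def in_keys_iff)

lemma multi_indices_zero [simp]: "0 \<in> multi_indices m"
  by (simp add: multi_indices_def)

lemma multi_indices_add_iff [simp]:
  "\<alpha> + \<beta> \<in> multi_indices m \<longleftrightarrow> \<alpha> \<in> multi_indices m \<and> \<beta> \<in> multi_indices m"
proof
  assume *: "\<alpha> + \<beta> \<in> multi_indices m"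
  show "\<alpha> \<in> multi_indices m \<and> \<beta> \<in> multi_indices m"
    using multi_indicesD[OF *] by (auto intro!: multi_indicesI simp: lookup_add)
qed (auto intro!: multi_indicesI simp: lookup_add multi_indicesD)

lemma deg_zero_imp: "\<alpha> \<in> multi_indices m \<Longrightarrow> deg m \<alpha> = 0 \<Longrightarrow> \<alpha> = 0"
  by (rule poly_mapping_eqI) (metis lookup_le_deg multi_indicesD le_zero_eq lookup_zero not_less)

lemma inj_on_restrict_lookup:
  "inj_on (\<lambda>\<beta>. restrict (lookup \<beta>) A) {\<beta> :: nat \<Rightarrow>\<^sub>0 nat. keys \<beta> \<subseteq> A}"
proof (rule inj_onI, rule poly_mapping_eqI)
  fix \<beta> \<gamma> :: "nat \<Rightarrow>\<^sub>0 nat" and i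
  assume *: "\<beta> \<in> {\<beta>. keys \<beta> \<subseteq> A}" "\<gamma> \<in> {\<beta>. keys \<beta> \<subseteq> A}" "restrict (lookup \<beta>) A = restrict (lookup \<gamma>) A"
  show "lookup \<beta> i = lookup \<gamma> i"
  proof (cases "i \<in> A")
    case True
    then show ?thesis using fun_cong[OF *(3), of i] by simp
  next
    case False
    then have "i \<notin> keys \<beta>" "i \<notin> keys \<gamma>" using * by auto
    then show ?thesis by (simp add: in_keys_iff)
  qed
qed

lemma finite_lookup_le:
  assumes "finite A"
  shows "finite {\<beta> :: nat \<Rightarrow>\<^sub>0 nat. keys \<beta> \<subseteq> A \<and> (\<forall>i. lookup \<beta> i \<le> N)}" (is "finite ?S")
proof (rule finite_imageD)
  have "(\<lambda>\<beta>. restrict (lookup \<beta>) A) ` ?S \<subseteq> PiE A (\<lambda>_. {..N})"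
    by auto
  then show "finite ((\<lambda>\<beta>. restrict (lookup \<beta>) A) ` ?S)"
    by (rule finite_subset) (use assms in \<open>auto intro: finite_PiE\<close>)
  show "inj_on (\<lambda>\<beta>. restrict (lookup \<beta>) A) ?S"
    by (rule inj_on_subset[OF inj_on_restrict_lookup]) auto
qed

lemma finite_deg_le: "finite {\<alpha> \<in> multi_indices m. deg m \<alpha> \<le> n}"
proof (rule finite_subset)
  show "{\<alpha> \<in> multi_indices m. deg m \<alpha> \<le> n} \<subseteq> {\<beta>. keys \<beta> \<subseteq> {..<m} \<and> (\<forall>i. lookup \<beta> i \<le> n)}"
  proof clarify
    fix \<alpha> assume *: "\<alpha> \<in> multi_indices m" "deg m \<alpha> \<le> n"
    have "lookup \<alpha> i \<le> n" for i
      using lookup_le_deg[of i m \<alpha>] multi_indicesD[OF *(1), of i] *(2) by (cases "i < m") auto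
    then show "keys \<alpha> \<subseteq> {..<m} \<and> (\<forall>i. lookup \<alpha> i \<le> n)"
      using *(1) by (simp add: multi_indices_def)
  qed
qed (rule finite_lookup_le, simp)

lemma finite_splittings [simp]: "finite {(\<beta>, \<gamma>). \<beta> + \<gamma> = (\<alpha> :: nat \<Rightarrow>\<^sub>0 nat)}"
proof -
  let ?B = "{\<beta>. keys \<beta> \<subseteq> keys \<alpha> \<and> (\<forall>i. lookup \<beta> i \<le> Max (insert 0 (lookup \<alpha> ` keys \<alpha>)))}"
  have *: "\<beta> \<in> ?B" if "\<beta> + \<gamma> = \<alpha>" for \<beta> \<gamma>
  proof -
    have le: "lookup \<beta> i \<le> lookup \<alpha> i" for i
      unfolding that[symmetric] by (simp add: lookup_add)
    have bd: "lookup \<alpha> i \<le> Max (insert 0 (lookup \<alpha> ` keys \<alpha>))" for i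
      by (cases "i \<in> keys \<alpha>") (auto simp: in_keys_iff)
    have "keys \<beta> \<subseteq> keys \<alpha>"
    proof
      fix i assume "i \<in> keys \<beta>"
      then show "i \<in> keys \<alpha>" using le[of i] by (simp add: in_keys_iff)
    qed
    then show ?thesis
      using order_trans[OF le bd] by blast
  qed
  have "{(\<beta>, \<gamma>). \<beta> + \<gamma> = \<alpha>} \<subseteq> ?B \<times> ?B"
  proof (rule subsetI)
    fix p assume "p \<in> {(\<beta>, \<gamma>). \<beta> + \<gamma> = \<alpha>}"
    then obtain \<beta> \<gamma> where p: "p = (\<beta>, \<gamma>)" and eq: "\<beta> + \<gamma> = \<alpha>" by blast
    have "\<beta> \<in> ?B" "\<gamma> \<in> ?B"
      using *[OF eq] *[of \<gamma> \<beta>] eq by (simp_all only: add.commute)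
    then show "p \<in> ?B \<times> ?B" unfolding p by (rule SigmaI)
  qed
  then show ?thesis
    by (rule finite_subset) (intro finite_cartesian_product finite_lookup_le; simp)
qed

section \<open>The ring of formal power series\<close>

text \<open>A type of its own lets the convolution product be the multiplication of a type class, so that
  ring identities are available to the simplifier.\<close>

typedef 'a mps = "UNIV :: 'a pseries set"
  morphisms coeff Mps ..

setup_lifting type_definition_mps

lemma mps_eqI: "(\<And>\<alpha>. coeff f \<alpha> = coeff g \<alpha>) \<Longrightarrow> f = g"
  by (metis coeff_inject ext)

instantiation mps :: (comm_ring_1) comm_ring_1
begin

lift_definition zero_mps :: "'a mps" is "const_pseries 0" .
lift_definition one_mps :: "'a mps" is "const_pseries 1" .
lift_definition plus_mps :: "'a mps \<Rightarrow> 'a mps \<Rightarrow> 'a mps" is "\<lambda>f g \<alpha>. f \<alpha> + g \<alpha>" .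
lift_definition minus_mps :: "'a mps \<Rightarrow> 'a mps \<Rightarrow> 'a mps" is "\<lambda>f g \<alpha>. f \<alpha> - g \<alpha>" .
lift_definition uminus_mps :: "'a mps \<Rightarrow> 'a mps" is "\<lambda>f \<alpha>. - f \<alpha>" .
lift_definition times_mps :: "'a mps \<Rightarrow> 'a mps \<Rightarrow> 'a mps"
  is "\<lambda>f g \<alpha>. \<Sum>(\<beta>, \<gamma>) | \<beta> + \<gamma> = \<alpha>. f \<beta> * g \<gamma>" .

instance
proof
  fix a b c :: "'a mps"
  show "a + b + c = a + (b + c)" "a + b = b + a" "- a + a = 0" "a - b = a + - b" "0 + a = a"
    by (transfer, auto simp: const_pseries_def fun_eq_iff)+
  show "(0::'a mps) \<noteq> 1"
    by transfer (auto simp: const_pseries_def fun_eq_iff)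
  show "(a + b) * c = a * c + b * c"
    by transfer (auto simp: fun_eq_iff distrib_right sum.distrib case_prod_unfold)
  show "a * b = b * a"
  proof (transfer, rule ext)
    fix f g :: "'a pseries" and \<alpha>
    show "(\<Sum>(\<beta>, \<gamma>) | \<beta> + \<gamma> = \<alpha>. f \<beta> * g \<gamma>) = (\<Sum>(\<beta>, \<gamma>) | \<beta> + \<gamma> = \<alpha>. g \<beta> * f \<gamma>)"
      by (rule sum.reindex_bij_witness[of _ "\<lambda>(\<beta>, \<gamma>). (\<gamma>, \<beta>)" "\<lambda>(\<beta>, \<gamma>). (\<gamma>, \<beta>)"])
        (auto simp: ac_simps)
  qed
  show "1 * a = a"
  proof (transfer, rule ext)
    fix f :: "'a pseries" and \<alpha> :: "nat \<Rightarrow>\<^sub>0 nat"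
    have "(\<Sum>(\<beta>, \<gamma>) | \<beta> + \<gamma> = \<alpha>. const_pseries 1 \<beta> * f \<gamma>)
        = (\<Sum>(\<beta>, \<gamma>) \<in> {(0, \<alpha>)}. const_pseries 1 \<beta> * f \<gamma>)"
      by (rule sum.mono_neutral_right) (auto simp: const_pseries_def split: if_splits)
    then show "(\<Sum>(\<beta>, \<gamma>) | \<beta> + \<gamma> = \<alpha>. const_pseries 1 \<beta> * f \<gamma>) = f \<alpha>"
      by (simp add: const_pseries_def)
  qed
  show "a * b * c = a * (b * c)"
  proof (transfer, rule ext)
    fix f g h :: "'a pseries" and \<alpha> :: "nat \<Rightarrow>\<^sub>0 nat"
    let ?S = "\<lambda>\<alpha> :: nat \<Rightarrow>\<^sub>0 nat. {(\<beta>, \<gamma>). \<beta> + \<gamma> = \<alpha>}"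
    have "(\<Sum>(\<beta>, \<gamma>) \<in> ?S \<alpha>. (\<Sum>(\<delta>, \<epsilon>) \<in> ?S \<beta>. f \<delta> * g \<epsilon>) * h \<gamma>)
        = (\<Sum>p \<in> ?S \<alpha>. \<Sum>q \<in> ?S (fst p). f (fst q) * g (snd q) * h (snd p))"
      by (simp add: case_prod_unfold sum_distrib_right)
    also have "\<dots> = (\<Sum>(p, q) \<in> Sigma (?S \<alpha>) (\<lambda>p. ?S (fst p)). f (fst q) * g (snd q) * h (snd p))"
      by (rule sum.Sigma) auto
    also have "\<dots> = (\<Sum>(p, q) \<in> Sigma (?S \<alpha>) (\<lambda>p. ?S (snd p)). f (fst p) * (g (fst q) * h (snd q)))"
      by (rule sum.reindex_bij_witness[of _
            "\<lambda>((a, y), (b, c)). ((a + b, c), (a, b))" "\<lambda>((x, c), (a, b)). ((a, b + c), (b, c))"])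
        (auto simp: ac_simps)
    also have "\<dots> = (\<Sum>p \<in> ?S \<alpha>. \<Sum>q \<in> ?S (snd p). f (fst p) * (g (fst q) * h (snd q)))"
      by (rule sum.Sigma[symmetric]) auto
    also have "\<dots> = (\<Sum>(\<beta>, \<gamma>) \<in> ?S \<alpha>. f \<beta> * (\<Sum>(\<delta>, \<epsilon>) \<in> ?S \<gamma>. g \<delta> * h \<epsilon>))"
      by (simp add: case_prod_unfold sum_distrib_left)
    finally show "(\<Sum>(\<beta>, \<gamma>) \<in> ?S \<alpha>. (\<Sum>(\<delta>, \<epsilon>) \<in> ?S \<beta>. f \<delta> * g \<epsilon>) * h \<gamma>)
      = (\<Sum>(\<beta>, \<gamma>) \<in> ?S \<alpha>. f \<beta> * (\<Sum>(\<delta>, \<epsilon>) \<in> ?S \<gamma>. g \<delta> * h \<epsilon>))" .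
  qed
qed

end

lemma coeff_zero [simp]: "coeff 0 \<alpha> = 0"
  by transfer (simp add: const_pseries_def)

lemma coeff_add [simp]: "coeff (f + g) \<alpha> = coeff f \<alpha> + coeff g \<alpha>"
  by transfer simp

lemma coeff_diff [simp]: "coeff (f - g) \<alpha> = coeff f \<alpha> - coeff g \<alpha>"
  by transfer simp

lemma coeff_uminus [simp]: "coeff (- f) \<alpha> = - coeff f \<alpha>"
  by transfer simp

lemma coeff_sum [simp]: "coeff (sum f A) \<alpha> = (\<Sum>i\<in>A. coeff (f i) \<alpha>)"
  by (induction A rule: infinite_finite_induct) auto

lemma coeff_mult: "coeff (f * g) \<alpha> = (\<Sum>(\<beta>, \<gamma>) | \<beta> + \<gamma> = \<alpha>. coeff f \<beta> * coeff g \<gamma>)"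
  by (rule fun_cong[OF times_mps.rep_eq])

definition monom :: "(nat \<Rightarrow>\<^sub>0 nat) \<Rightarrow> 'a \<Rightarrow> 'a::comm_ring_1 mps" where
  "monom \<alpha> c = Mps (\<lambda>\<beta>. if \<beta> = \<alpha> then c else 0)"

lemma coeff_monom [simp]: "coeff (monom \<alpha> c) \<beta> = (if \<beta> = \<alpha> then c else 0)"
  by (simp add: monom_def Mps_inverse)

lemma coeff_monom_mult_add [simp]: "coeff (monom \<alpha> c * f) (\<alpha> + \<beta>) = c * coeff f \<beta>"
proof -
  have "coeff (monom \<alpha> c * f) (\<alpha> + \<beta>)
      = (\<Sum>(\<delta>, \<gamma>) \<in> {(\<alpha>, \<beta>)}. coeff (monom \<alpha> c) \<delta> * coeff f \<gamma>)"
    unfolding coeff_mult by (rule sum.mono_neutral_right) (auto split: if_splits)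
  then show ?thesis by simp
qed

lemma coeff_monom_mult_eq_0:
  "(\<And>\<gamma>. \<beta> \<noteq> \<alpha> + \<gamma>) \<Longrightarrow> coeff (monom \<alpha> c * f) \<beta> = 0"
  unfolding coeff_mult by (rule sum.neutral) auto

lemma coeff_const_mult [simp]: "coeff (monom 0 c * f) \<beta> = c * coeff f \<beta>"
  using coeff_monom_mult_add[of 0 c f \<beta>] by simp

lemma monom_0_1: "monom 0 1 = 1"
  by (rule mps_eqI) (transfer, simp add: const_pseries_def)

section \<open>Convergent power series\<close>

text \<open>Convergence as geometric growth of the coefficients; \<open>convergent_pseries_iff\<close> is the
  equivalence with absolute convergence on a polydisc.\<close>

definition conv :: "nat \<Rightarrow> 'a::real_normed_field mps \<Rightarrow> bool" where
  "conv m f \<longleftrightarrow> (\<forall>\<alpha>. \<alpha> \<notin> multi_indices m \<longrightarrow> coeff f \<alpha> = 0) \<and>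
     (\<exists>r>0. \<exists>C. \<forall>\<alpha>. norm (coeff f \<alpha>) * r ^ deg m \<alpha> \<le> C)"

lemma conv_supp: "conv m f \<Longrightarrow> \<alpha> \<notin> multi_indices m \<Longrightarrow> coeff f \<alpha> = 0"
  by (simp add: conv_def)

lemma convI:
  assumes "\<And>\<alpha>. \<alpha> \<notin> multi_indices m \<Longrightarrow> coeff f \<alpha> = 0" "r > 0"
    and "\<And>\<alpha>. \<alpha> \<in> multi_indices m \<Longrightarrow> norm (coeff f \<alpha>) * r ^ deg m \<alpha> \<le> C"
  shows "conv m f"
proof -
  have "norm (coeff f \<alpha>) * r ^ deg m \<alpha> \<le> max C 0" for \<alpha>
    using assms(1)[of \<alpha>] assms(3)[of \<alpha>] by (cases "\<alpha> \<in> multi_indices m") (auto simp: le_max_iff_disj)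
  then show ?thesis using assms(1,2) unfolding conv_def by blast
qed

lemma conv_bound:
  assumes "conv m f" "0 < \<epsilon>"
  shows "\<exists>r C. 0 < r \<and> r \<le> \<epsilon> \<and> 0 \<le> C \<and> (\<forall>\<alpha>. norm (coeff f \<alpha>) * r ^ deg m \<alpha> \<le> C)"
proof -
  from assms(1) obtain r C where r: "r > 0" and C: "\<And>\<alpha>. norm (coeff f \<alpha>) * r ^ deg m \<alpha> \<le> C"
    unfolding conv_def by blast
  have "norm (coeff f \<alpha>) * (min r \<epsilon>) ^ deg m \<alpha> \<le> C" for \<alpha>
    by (rule order_trans[OF mult_left_mono C]) (use r assms in \<open>auto intro!: power_mono\<close>)
  moreover have "0 \<le> C"
    by (rule order_trans[OF _ C[of 0]]) simp
  ultimately show ?thesis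
    using r assms by (intro exI[of _ "min r \<epsilon>"] exI[of _ C]) auto
qed

text \<open>The sum over a box of multi-indices is a product of \<open>m\<close> geometric sums, each of them at most \<open>2\<close>.\<close>

lemma sum_geometric_multi_indices_le:
  assumes "finite S" "S \<subseteq> multi_indices m"
  shows "(\<Sum>\<delta>\<in>S. (1/2::real) ^ deg m \<delta>) \<le> 2 ^ m"
proof -
  define N where "N = Max (insert 0 (deg m ` S))"
  let ?R = "\<lambda>\<beta>. restrict (lookup \<beta>) {..<m}"
  let ?B = "{..<m} \<rightarrow>\<^sub>E {..N}"
  have N: "deg m \<delta> \<le> N" if "\<delta> \<in> S" for \<delta>
    unfolding N_def using assms(1) that by simp
  have inj: "inj_on ?R S"
    using assms(2) by (intro inj_on_subset[OF inj_on_restrict_lookup]) (auto simp: multi_indices_def)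
  have sub: "?R ` S \<subseteq> ?B"
  proof (rule image_subsetI)
    fix \<delta> assume "\<delta> \<in> S"
    then have "lookup \<delta> i \<le> N" if "i < m" for i
      using order_trans[OF lookup_le_deg[OF that] N] by blast
    then show "?R \<delta> \<in> ?B" by auto
  qed
  have geo: "(\<Sum>k\<le>n. (1/2::real) ^ k) = 2 - (1/2) ^ n" for n
    by (induction n) auto
  have "(\<Sum>\<delta>\<in>S. (1/2::real) ^ deg m \<delta>) = (\<Sum>\<delta>\<in>S. \<Prod>i<m. (1/2) ^ (?R \<delta> i))"
    by (simp add: deg_def power_sum)
  also have "\<dots> = (\<Sum>g\<in>?R ` S. \<Prod>i<m. (1/2) ^ g i)"
    using sum.reindex[OF inj, of "\<lambda>g. \<Prod>i<m. (1/2::real) ^ g i"] by simp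
  also have "\<dots> \<le> (\<Sum>g\<in>?B. \<Prod>i<m. (1/2) ^ g i)"
    by (rule sum_mono2[OF _ sub]) (auto intro: finite_PiE prod_nonneg)
  also have "\<dots> = (\<Prod>i<m. \<Sum>k\<le>N. (1/2) ^ k)"
    by (rule prod_sum_PiE[symmetric]) auto
  also have "\<dots> \<le> (\<Prod>i<m. 2)"
  proof (rule prod_mono)
    have "0 \<le> (1/2::real) ^ N" "(1/2::real) ^ N \<le> 1" by (auto intro: power_le_one)
    then show "0 \<le> (\<Sum>k\<le>N. (1/2::real) ^ k) \<and> (\<Sum>k\<le>N. (1/2::real) ^ k) \<le> 2" for i :: nat
      unfolding geo by linarith
  qed
  finally show ?thesis by simp
qed

lemma sum_coeff_le:
  assumes "finite S" "S \<subseteq> multi_indices m" "r \<ge> 0"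
    and "\<And>\<alpha>. norm (coeff f \<alpha>) * r ^ deg m \<alpha> \<le> C"
  shows "(\<Sum>\<delta>\<in>S. norm (coeff f \<delta>) * (r/2) ^ deg m \<delta>) \<le> C * 2 ^ m"
proof -
  have "0 \<le> C"
    by (rule order_trans[OF _ assms(4)[of 0]]) simp
  have "(\<Sum>\<delta>\<in>S. norm (coeff f \<delta>) * (r/2) ^ deg m \<delta>) \<le> (\<Sum>\<delta>\<in>S. C * (1/2) ^ deg m \<delta>)"
  proof (rule sum_mono)
    fix \<delta>
    have "norm (coeff f \<delta>) * (r/2) ^ deg m \<delta> = (norm (coeff f \<delta>) * r ^ deg m \<delta>) * (1/2) ^ deg m \<delta>"
      by (simp add: power_divide)
    also have "\<dots> \<le> C * (1/2) ^ deg m \<delta>"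
      by (rule mult_right_mono[OF assms(4)]) simp
    finally show "norm (coeff f \<delta>) * (r/2) ^ deg m \<delta> \<le> C * (1/2) ^ deg m \<delta>" .
  qed
  also have "\<dots> = C * (\<Sum>\<delta>\<in>S. (1/2) ^ deg m \<delta>)"
    by (simp add: sum_distrib_left)
  also have "\<dots> \<le> C * 2 ^ m"
    by (rule mult_left_mono[OF sum_geometric_multi_indices_le[OF assms(1,2)] \<open>0 \<le> C\<close>])
  finally show ?thesis .
qed

lemma conv_zero [simp]: "conv m 0"
  by (rule convI[of _ _ 1 0]) auto

lemma conv_uminus: "conv m f \<Longrightarrow> conv m (- f)"
  by (simp add: conv_def)

lemma conv_add:
  assumes "conv m f" "conv m g"
  shows "conv m (f + g)"
proof -
  obtain r C where f: "0 < r" "r \<le> 1" "0 \<le> C" "\<And>\<alpha>. norm (coeff f \<alpha>) * r ^ deg m \<alpha> \<le> C"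
    using conv_bound[OF assms(1) zero_less_one] by blast
  obtain r' C' where g: "0 < r'" "r' \<le> r" "0 \<le> C'" "\<And>\<alpha>. norm (coeff g \<alpha>) * r' ^ deg m \<alpha> \<le> C'"
    using conv_bound[OF assms(2) f(1)] by blast
  show ?thesis
  proof (rule convI[of _ _ r' "C + C'"])
    fix \<alpha>
    have "norm (coeff (f + g) \<alpha>) * r' ^ deg m \<alpha>
        \<le> norm (coeff f \<alpha>) * r' ^ deg m \<alpha> + norm (coeff g \<alpha>) * r' ^ deg m \<alpha>"
      using g(1) by (simp add: norm_triangle_ineq mult_right_mono flip: distrib_right)
    also have "norm (coeff f \<alpha>) * r' ^ deg m \<alpha> \<le> norm (coeff f \<alpha>) * r ^ deg m \<alpha>"
      using g by (intro mult_left_mono power_mono) auto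
    finally show "norm (coeff (f + g) \<alpha>) * r' ^ deg m \<alpha> \<le> C + C'"
      using f(4)[of \<alpha>] g(4)[of \<alpha>] by linarith
  qed (use assms g(1) in \<open>auto simp: conv_supp\<close>)
qed

lemma conv_diff: "conv m f \<Longrightarrow> conv m g \<Longrightarrow> conv m (f - g)"
  using conv_add[of m f "- g"] conv_uminus[of m g] by simp

lemma conv_sum: "(\<And>i. i \<in> A \<Longrightarrow> conv m (f i)) \<Longrightarrow> conv m (sum f A)"
  by (induction A rule: infinite_finite_induct) (auto intro: conv_add)

lemma conv_monom: "\<alpha> \<in> multi_indices m \<Longrightarrow> conv m (monom \<alpha> c)"
  by (rule convI[of _ _ 1 "norm c"]) auto

lemma conv_one [simp]: "conv m 1"
  using conv_monom[of 0 m 1] by (simp add: monom_0_1)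

text \<open>On half the radius one factor is absolutely summable while the terms of the other are bounded,
  so the convolution stays bounded.\<close>

lemma conv_mult:
  assumes "conv m f" "conv m g"
  shows "conv m (f * g)"
proof -
  obtain r C where f: "0 < r" "r \<le> 1" "0 \<le> C" "\<And>\<alpha>. norm (coeff f \<alpha>) * r ^ deg m \<alpha> \<le> C"
    using conv_bound[OF assms(1) zero_less_one] by blast
  obtain r' C' where g: "0 < r'" "r' \<le> r" "0 \<le> C'" "\<And>\<alpha>. norm (coeff g \<alpha>) * r' ^ deg m \<alpha> \<le> C'"
    using conv_bound[OF assms(2) f(1)] by blast
  have f': "norm (coeff f \<alpha>) * (r'/2) ^ deg m \<alpha> \<le> C" for \<alpha>
    by (rule order_trans[OF mult_left_mono f(4)]) (use g in \<open>auto intro!: power_mono\<close>)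
  show ?thesis
  proof (rule convI[of _ _ "r'/2" "C * (C' * 2 ^ m)"])
    fix \<alpha> assume "\<alpha> \<in> multi_indices m"
    let ?S = "{(\<beta>, \<gamma>). \<beta> + \<gamma> = \<alpha>}"
    have fin: "finite (snd ` ?S)" by (rule finite_imageI, rule finite_splittings)
    have sub: "snd ` ?S \<subseteq> multi_indices m"
      using \<open>\<alpha> \<in> multi_indices m\<close> by auto
    have "norm (coeff (f * g) \<alpha>) * (r'/2) ^ deg m \<alpha>
        \<le> (\<Sum>p\<in>?S. norm (coeff f (fst p) * coeff g (snd p))) * (r'/2) ^ deg m \<alpha>"
      unfolding coeff_mult case_prod_unfold using g(1)
      by (intro mult_right_mono norm_sum) auto
    also have "\<dots> = (\<Sum>p\<in>?S. (norm (coeff f (fst p)) * (r'/2) ^ deg m (fst p)) *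
                               (norm (coeff g (snd p)) * (r'/2) ^ deg m (snd p)))"
      unfolding sum_distrib_right
      by (rule sum.cong[OF refl]) (auto simp: norm_mult power_add)
    also have "\<dots> \<le> (\<Sum>p\<in>?S. C * (norm (coeff g (snd p)) * (r'/2) ^ deg m (snd p)))"
      using g(1) by (intro sum_mono mult_right_mono f') auto
    also have "\<dots> = C * (\<Sum>\<gamma>\<in>snd ` ?S. norm (coeff g \<gamma>) * (r'/2) ^ deg m \<gamma>)"
    proof -
      have "inj_on snd ?S" by (auto simp: inj_on_def)
      then show ?thesis
        by (simp add: sum.reindex sum_distrib_left)
    qed
    also have "\<dots> \<le> C * (C' * 2 ^ m)"
      by (rule mult_left_mono[OF sum_coeff_le[OF fin sub _ g(4)] f(3)]) (use g in simp)
    finally show "norm (coeff (f * g) \<alpha>) * (r'/2) ^ deg m \<alpha> \<le> C * (C' * 2 ^ m)" .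
  next
    fix \<alpha> assume "\<alpha> \<notin> multi_indices m"
    then have "\<beta> \<notin> multi_indices m \<or> \<gamma> \<notin> multi_indices m" if "\<beta> + \<gamma> = \<alpha>" for \<beta> \<gamma>
      using that by auto
    then show "coeff (f * g) \<alpha> = 0"
      unfolding coeff_mult by (intro sum.neutral) (use assms in \<open>auto dest: conv_supp\<close>)
  qed (use g in auto)
qed

text \<open>This is the \<open>n\<close>-th power of the maximal ideal, by lemma \<open>ideal_power_eq\<close> below.\<close>

definition ord_ge :: "nat \<Rightarrow> nat \<Rightarrow> 'a::real_normed_field mps set" where
  "ord_ge m n = {f. conv m f \<and> (\<forall>\<alpha>. deg m \<alpha> < n \<longrightarrow> coeff f \<alpha> = 0)}"

lemma ord_ge_conv: "f \<in> ord_ge m n \<Longrightarrow> conv m f"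
  by (simp add: ord_ge_def)

lemma ord_ge_0 [simp]: "ord_ge m 0 = {f. conv m f}"
  by (simp add: ord_ge_def)

lemma ord_ge_zero [simp]: "0 \<in> ord_ge m n"
  by (simp add: ord_ge_def)

lemma ord_ge_add: "f \<in> ord_ge m n \<Longrightarrow> g \<in> ord_ge m n \<Longrightarrow> f + g \<in> ord_ge m n"
  by (simp add: ord_ge_def conv_add)

lemma ord_ge_diff: "f \<in> ord_ge m n \<Longrightarrow> g \<in> ord_ge m n \<Longrightarrow> f - g \<in> ord_ge m n"
  by (simp add: ord_ge_def conv_diff)

lemma ord_ge_uminus: "f \<in> ord_ge m n \<Longrightarrow> - f \<in> ord_ge m n"
  by (simp add: ord_ge_def conv_uminus)

lemma ord_ge_sum: "(\<And>i. i \<in> A \<Longrightarrow> f i \<in> ord_ge m n) \<Longrightarrow> sum f A \<in> ord_ge m n"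
  by (induction A rule: infinite_finite_induct) (auto intro: ord_ge_add)

lemma ord_ge_antimono: "f \<in> ord_ge m n \<Longrightarrow> n' \<le> n \<Longrightarrow> f \<in> ord_ge m n'"
  by (simp add: ord_ge_def)

lemma ord_ge_mult:
  assumes "f \<in> ord_ge m k" "g \<in> ord_ge m n"
  shows "f * g \<in> ord_ge m (k + n)"
  unfolding ord_ge_def
proof (intro CollectI conjI allI impI)
  show "conv m (f * g)" using assms by (simp add: ord_ge_def conv_mult)
  fix \<alpha> assume "deg m \<alpha> < k + n"
  then have "deg m \<beta> < k \<or> deg m \<gamma> < n" if "\<beta> + \<gamma> = \<alpha>" for \<beta> \<gamma>
    using that by auto
  then show "coeff (f * g) \<alpha> = 0"
    unfolding coeff_mult by (intro sum.neutral) (use assms in \<open>auto simp: ord_ge_def\<close>)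
qed

lemma ord_ge_mult_left: "conv m f \<Longrightarrow> g \<in> ord_ge m n \<Longrightarrow> f * g \<in> ord_ge m n"
  using ord_ge_mult[of f m 0 g n] by simp

lemma ord_ge_mult_right: "f \<in> ord_ge m n \<Longrightarrow> conv m g \<Longrightarrow> f * g \<in> ord_ge m n"
  using ord_ge_mult[of f m n g 0] by simp

section \<open>The monomial order\<close>

text \<open>The degree is compared first, so that leading exponents know the order of vanishing, and the
  lexicographic order breaks ties. In finitely many variables only finitely many monomials precede
  a given one, which makes recursion along the order possible.\<close>

definition prec :: "nat \<Rightarrow> (nat \<Rightarrow>\<^sub>0 nat) \<Rightarrow> (nat \<Rightarrow>\<^sub>0 nat) \<Rightarrow> bool" where
  "prec m \<alpha> \<beta> \<longleftrightarrow> deg m \<alpha> < deg m \<beta> \<or> deg m \<alpha> = deg m \<beta> \<and> \<alpha> < \<beta>"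

lemma prec_irrefl [simp]: "\<not> prec m \<alpha> \<alpha>"
  by (simp add: prec_def)

lemma prec_trans: "prec m \<alpha> \<beta> \<Longrightarrow> prec m \<beta> \<gamma> \<Longrightarrow> prec m \<alpha> \<gamma>"
  by (auto simp: prec_def)

lemma prec_total: "\<alpha> \<noteq> \<beta> \<Longrightarrow> prec m \<alpha> \<beta> \<or> prec m \<beta> \<alpha>"
  by (auto simp: prec_def)

lemma prec_add_right: "prec m \<alpha> \<beta> \<Longrightarrow> prec m (\<alpha> + \<gamma>) (\<beta> + \<gamma>)"
  by (auto simp: prec_def)

lemma prec_deg_le: "prec m \<alpha> \<beta> \<Longrightarrow> deg m \<alpha> \<le> deg m \<beta>"
  by (auto simp: prec_def)

lemma finite_prec: "finite {\<alpha> \<in> multi_indices m. prec m \<alpha> \<beta>}"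
  by (rule finite_subset[OF _ finite_deg_le[of m "deg m \<beta>"]]) (auto dest: prec_deg_le)

lemma wf_prec: "wf {(\<alpha>, \<beta>). \<alpha> \<in> multi_indices m \<and> \<beta> \<in> multi_indices m \<and> prec m \<alpha> \<beta>}"
proof (rule wf_subset[OF wf_measure])
  show "{(\<alpha>, \<beta>). \<alpha> \<in> multi_indices m \<and> \<beta> \<in> multi_indices m \<and> prec m \<alpha> \<beta>}
      \<subseteq> measure (\<lambda>\<beta>. card {\<alpha> \<in> multi_indices m. prec m \<alpha> \<beta>})"
  proof clarsimp
    fix \<alpha> \<beta> assume "\<alpha> \<in> multi_indices m" "prec m \<alpha> \<beta>"
    then have "{\<gamma> \<in> multi_indices m. prec m \<gamma> \<alpha>} \<subset> {\<gamma> \<in> multi_indices m. prec m \<gamma> \<beta>}"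
      using prec_trans[of m _ \<alpha> \<beta>] by (force simp: psubset_eq)
    then show "card {\<gamma> \<in> multi_indices m. prec m \<gamma> \<alpha>} < card {\<gamma> \<in> multi_indices m. prec m \<gamma> \<beta>}"
      by (intro psubset_card_mono finite_prec)
  qed
qed

text \<open>On multi-indices of a degree below \<open>B\<close> the lexicographic order is refined by the
  numerical order of the values with digits in base \<open>B\<close>.\<close>

definition lex_value :: "nat \<Rightarrow> nat \<Rightarrow> (nat \<Rightarrow>\<^sub>0 nat) \<Rightarrow> nat" where
  "lex_value B m \<alpha> = (\<Sum>i<m. lookup \<alpha> i * B ^ (m - i))"

lemma lex_value_add: "lex_value B m (\<alpha> + \<beta>) = lex_value B m \<alpha> + lex_value B m \<beta>"
  by (simp add: lex_value_def lookup_add sum.distrib distrib_right)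

lemma lex_value_le: "1 \<le> B \<Longrightarrow> lex_value B m \<alpha> \<le> B ^ m * deg m \<alpha>"
  unfolding lex_value_def deg_def sum_distrib_left
  by (rule sum_mono) (simp add: mult.commute power_increasing)

lemma lex_value_less:
  assumes "\<alpha> < \<beta>" "\<beta> \<in> multi_indices m" "deg m \<alpha> < B"
  shows "lex_value B m \<alpha> < lex_value B m \<beta>"
proof -
  obtain k where k: "lookup \<alpha> k < lookup \<beta> k" and eq: "\<And>i. i < k \<Longrightarrow> lookup \<alpha> i = lookup \<beta> i"
    using assms(1) unfolding less_poly_mapping.rep_eq less_fun_def by blast
  have km: "k < m"
    using k multi_indicesD[OF assms(2), of k] by (cases "k < m") auto
  have split: "lex_value B m \<gamma> = (\<Sum>i<k. lookup \<gamma> i * B ^ (m - i)) + lookup \<gamma> k * B ^ (m - k)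
      + (\<Sum>i\<in>{k<..<m}. lookup \<gamma> i * B ^ (m - i))" for \<gamma>
  proof -
    have *: "{..<m} = insert k ({..<k} \<union> {k<..<m})" using km by auto
    show ?thesis
      unfolding lex_value_def * by (subst sum.insert, simp, simp, subst sum.union_disjoint) auto
  qed
  have "(\<Sum>i\<in>{k<..<m}. lookup \<alpha> i * B ^ (m - i)) \<le> (\<Sum>i\<in>{k<..<m}. lookup \<alpha> i * B ^ (m - Suc k))"
    using assms(3) by (intro sum_mono mult_left_mono power_increasing) auto
  also have "\<dots> \<le> deg m \<alpha> * B ^ (m - Suc k)"
    unfolding deg_def sum_distrib_right by (rule sum_mono2) auto
  also have "\<dots> < B * B ^ (m - Suc k)"
    using assms(3) by simp
  also have "\<dots> = B ^ (m - k)"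
    using km by (metis Suc_diff_Suc power_Suc)
  finally have "lex_value B m \<alpha>
      < (\<Sum>i<k. lookup \<beta> i * B ^ (m - i)) + Suc (lookup \<alpha> k) * B ^ (m - k)"
    using eq by (simp add: split)
  also have "\<dots> \<le> lex_value B m \<beta>"
    unfolding split[of \<beta>] using k mult_right_mono[of "Suc (lookup \<alpha> k)" "lookup \<beta> k" "B ^ (m - k)"]
    by simp
  finally show ?thesis .
qed

section \<open>Division with remainder\<close>

definition leads :: "nat \<Rightarrow> 'a::real_normed_field mps \<Rightarrow> (nat \<Rightarrow>\<^sub>0 nat) \<Rightarrow> bool" where
  "leads m f \<alpha> \<longleftrightarrow> coeff f \<alpha> \<noteq> 0 \<and> (\<forall>\<beta>. coeff f \<beta> \<noteq> 0 \<longrightarrow> \<not> prec m \<beta> \<alpha>)"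

text \<open>The absolute value of the monomial at the polyradius with entries \<open>t * s ^ (B ^ (m - i))\<close>. Small \<open>t\<close>
  prefers low degrees, and among the monomials of a fixed degree below \<open>B\<close> small \<open>s\<close> prefers the
  lexicographically smaller ones.\<close>

definition weight :: "real \<Rightarrow> real \<Rightarrow> nat \<Rightarrow> nat \<Rightarrow> (nat \<Rightarrow>\<^sub>0 nat) \<Rightarrow> real" where
  "weight t s B m \<alpha> = t ^ deg m \<alpha> * s ^ lex_value B m \<alpha>"

lemma weight_add: "weight t s B m (\<alpha> + \<beta>) = weight t s B m \<alpha> * weight t s B m \<beta>"
  by (simp add: weight_def lex_value_add power_add)

lemma weight_pos: "0 < t \<Longrightarrow> 0 < s \<Longrightarrow> 0 < weight t s B m \<alpha>"
  by (simp add: weight_def)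

lemma weight_le: "0 < t \<Longrightarrow> 0 < s \<Longrightarrow> s \<le> 1 \<Longrightarrow> weight t s B m \<alpha> \<le> t ^ deg m \<alpha>"
  by (simp add: weight_def mult_left_le power_le_one)

lemma weight_ge:
  assumes "0 < t" "0 < s" "s \<le> 1" "1 \<le> B"
  shows "(t * s ^ (B ^ m)) ^ deg m \<alpha> \<le> weight t s B m \<alpha>"
proof -
  have "s ^ (B ^ m * deg m \<alpha>) \<le> s ^ lex_value B m \<alpha>"
    using assms by (intro power_decreasing lex_value_le) auto
  then show ?thesis
    using assms(1) by (simp add: weight_def power_mult_distrib power_mult)
qed

lemma conv_weightI:
  assumes "\<And>\<alpha>. \<alpha> \<notin> multi_indices m \<Longrightarrow> coeff f \<alpha> = 0" "0 < t" "0 < s" "s \<le> 1" "1 \<le> B"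
    and "\<And>\<alpha>. \<alpha> \<in> multi_indices m \<Longrightarrow> norm (coeff f \<alpha>) * weight t s B m \<alpha> \<le> C"
  shows "conv m f"
proof (rule convI[OF assms(1)])
  show "0 < t * s ^ (B ^ m)" using assms by simp
  fix \<alpha> assume "\<alpha> \<in> multi_indices m"
  then show "norm (coeff f \<alpha>) * (t * s ^ (B ^ m)) ^ deg m \<alpha> \<le> C"
    using order_trans[OF mult_left_mono[OF weight_ge[OF assms(2-5)] norm_ge_zero] assms(6)] by blast
qed

lemma eventually_mult_le_at_right_0:
  fixes \<epsilon> K :: real
  assumes "0 < \<epsilon>"
  shows "\<forall>\<^sub>F t in at_right 0. t * K \<le> \<epsilon>"
proof -
  have "((\<lambda>t. t * K) \<longlongrightarrow> 0 * K) (at_right 0)"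
    by (intro tendsto_intros)
  then have "\<forall>\<^sub>F t in at_right 0. t * K < \<epsilon>"
    using assms by (intro order_tendstoD(2)) auto
  then show ?thesis by (rule eventually_mono) simp
qed

text \<open>Among the terms after \<open>a\<close>, those of the same degree gain at least one factor \<open>s\<close>, by
  \<open>lex_value_less\<close>. Those of higher degree gain a factor \<open>t\<close>, but may lose powers of \<open>s\<close>; hence \<open>t\<close> is
  chosen after \<open>s\<close>.\<close>

lemma weight_dominates:
  fixes u :: "'a::real_normed_field mps"
  assumes u: "conv m u" and a: "a \<in> multi_indices m" "deg m a < B"
    and prec: "\<And>\<delta>. coeff u \<delta> \<noteq> 0 \<Longrightarrow> prec m a \<delta>" and "0 < \<epsilon>"
  shows "\<forall>\<^sub>F s in at_right 0. \<forall>\<^sub>F t in at_right 0.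
           \<forall>S. finite S \<longrightarrow> (\<Sum>\<delta>\<in>S. norm (coeff u \<delta>) * weight t s B m \<delta>) \<le> \<epsilon> * weight t s B m a"
proof -
  let ?d = "deg m a"
  obtain r C where r: "0 < r" and C: "0 \<le> C" "\<And>\<alpha>. norm (coeff u \<alpha>) * r ^ deg m \<alpha> \<le> C"
    using conv_bound[OF u zero_less_one] by blast
  let ?D = "{\<delta> \<in> multi_indices m. deg m \<delta> \<le> ?d}"
  define A where "A = (\<Sum>\<delta>\<in>?D. norm (coeff u \<delta>))"
  define K where "K = C * 2 ^ m * (2 / r) ^ Suc ?d"
  have low: "(\<Sum>\<delta>\<in>S. norm (coeff u \<delta>) * weight t s B m \<delta>) \<le> weight t s B m a * (s * A)"
    if S: "finite S" "\<And>\<delta>. \<delta> \<in> S \<Longrightarrow> \<delta> \<in> multi_indices m \<and> prec m a \<delta> \<and> deg m \<delta> = ?d"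
      and ts: "0 < t" "0 < s" "s \<le> 1" for S s t
  proof -
    have "weight t s B m \<delta> \<le> weight t s B m a * s" if "\<delta> \<in> S" for \<delta>
    proof -
      have "lex_value B m a < lex_value B m \<delta>"
        using S(2)[OF that] a by (intro lex_value_less) (auto simp: prec_def)
      then have "s ^ lex_value B m \<delta> \<le> s ^ Suc (lex_value B m a)"
        using ts by (intro power_decreasing) auto
      then show ?thesis
        using S(2)[OF that] ts by (simp add: weight_def mult_ac)
    qed
    then have "(\<Sum>\<delta>\<in>S. norm (coeff u \<delta>) * weight t s B m \<delta>)
        \<le> (\<Sum>\<delta>\<in>S. norm (coeff u \<delta>) * (weight t s B m a * s))"
      by (intro sum_mono mult_left_mono) auto
    also have "\<dots> \<le> (\<Sum>\<delta>\<in>?D. norm (coeff u \<delta>) * (weight t s B m a * s))"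
      using S ts weight_pos[of t s B m a] by (intro sum_mono2 finite_deg_le) (auto intro: less_imp_le)
    also have "\<dots> = weight t s B m a * (s * A)"
      by (simp add: A_def sum_distrib_left sum_distrib_right mult_ac)
    finally show ?thesis .
  qed
  have high: "(\<Sum>\<delta>\<in>S. norm (coeff u \<delta>) * weight t s B m \<delta>) \<le> t ^ ?d * (t * K)"
    if S: "finite S" "\<And>\<delta>. \<delta> \<in> S \<Longrightarrow> \<delta> \<in> multi_indices m \<and> ?d < deg m \<delta>"
      and ts: "0 < t" "0 < s" "s \<le> 1" "t * 2 \<le> r" for S s t
  proof -
    let ?x = "2 * t / r"
    have x: "0 \<le> ?x" "?x \<le> 1" using ts r by (auto simp: field_simps)
    have "norm (coeff u \<delta>) * weight t s B m \<delta> \<le> C * ?x ^ Suc ?d * (1/2) ^ deg m \<delta>" if "\<delta> \<in> S" for \<delta>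
    proof -
      have "norm (coeff u \<delta>) * weight t s B m \<delta> \<le> norm (coeff u \<delta>) * t ^ deg m \<delta>"
        using ts by (intro mult_left_mono weight_le) auto
      also have "\<dots> = (norm (coeff u \<delta>) * r ^ deg m \<delta>) * (?x ^ deg m \<delta> * (1/2) ^ deg m \<delta>)"
        using r by (simp add: power_divide power_mult_distrib)
      also have "\<dots> \<le> C * (?x ^ deg m \<delta> * (1/2) ^ deg m \<delta>)"
        using x by (intro mult_right_mono C(2)) auto
      also have "\<dots> \<le> C * (?x ^ Suc ?d * (1/2) ^ deg m \<delta>)"
        using S(2)[OF that] x C(1) by (intro mult_left_mono mult_right_mono power_decreasing) auto
      finally show ?thesis by (simp add: mult_ac)
    qed
    then have "(\<Sum>\<delta>\<in>S. norm (coeff u \<delta>) * weight t s B m \<delta>)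
        \<le> (\<Sum>\<delta>\<in>S. C * ?x ^ Suc ?d * (1/2) ^ deg m \<delta>)"
      by (rule sum_mono)
    also have "\<dots> = C * ?x ^ Suc ?d * (\<Sum>\<delta>\<in>S. (1/2) ^ deg m \<delta>)"
      by (rule sum_distrib_left[symmetric])
    also have "\<dots> \<le> C * ?x ^ Suc ?d * 2 ^ m"
      by (rule mult_left_mono[OF sum_geometric_multi_indices_le mult_nonneg_nonneg])
        (use S x C(1) in \<open>auto intro!: zero_le_power simp del: power_Suc\<close>)
    also have "\<dots> = t ^ ?d * (t * K)"
      by (simp add: K_def power_mult_distrib power_divide mult_ac)
    finally show ?thesis .
  qed
  have main: "(\<Sum>\<delta>\<in>S. norm (coeff u \<delta>) * weight t s B m \<delta>) \<le> \<epsilon> * weight t s B m a"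
    if S: "finite S" and s: "0 < s" "s * 1 \<le> 1" "s * A \<le> \<epsilon> / 2"
      and t: "0 < t" "t * 2 \<le> r" "t * K \<le> \<epsilon> / 2 * s ^ lex_value B m a" for S s t
  proof -
    let ?f = "\<lambda>\<delta>. norm (coeff u \<delta>) * weight t s B m \<delta>"
    let ?S1 = "{\<delta> \<in> S. \<delta> \<in> multi_indices m \<and> prec m a \<delta> \<and> deg m \<delta> = ?d}"
    let ?S2 = "{\<delta> \<in> S. \<delta> \<in> multi_indices m \<and> ?d < deg m \<delta>}"
    have "sum ?f S = sum ?f (?S1 \<union> ?S2)"
    proof (rule sum.mono_neutral_right[OF S], blast, rule ballI)
      fix \<delta> assume \<delta>: "\<delta> \<in> S - (?S1 \<union> ?S2)"
      have "coeff u \<delta> = 0"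
      proof (rule ccontr)
        assume "coeff u \<delta> \<noteq> 0"
        then have "prec m a \<delta>" "\<delta> \<in> multi_indices m" using prec conv_supp[OF u] by auto
        then show False using \<delta> by (auto simp: prec_def)
      qed
      then show "?f \<delta> = 0" by simp
    qed
    also have "\<dots> = sum ?f ?S1 + sum ?f ?S2"
      using S by (intro sum.union_disjoint) auto
    also have "\<dots> \<le> weight t s B m a * (s * A) + t ^ ?d * (t * K)"
      using S s t by (intro add_mono low high) auto
    also have "\<dots> \<le> weight t s B m a * (\<epsilon> / 2) + t ^ ?d * (\<epsilon> / 2 * s ^ lex_value B m a)"
      using s t weight_pos[of t s B m a] by (intro add_mono mult_left_mono) auto
    also have "\<dots> = \<epsilon> * weight t s B m a"
      by (simp add: weight_def mult_ac)
    finally show ?thesis .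
  qed
  have "\<forall>\<^sub>F s in at_right 0. 0 < s \<and> s * 1 \<le> 1 \<and> s * A \<le> \<epsilon> / 2"
    using \<open>0 < \<epsilon>\<close> by (intro eventually_conj eventually_mult_le_at_right_0 eventually_at_right_less) auto
  then show ?thesis
  proof (rule eventually_mono)
    fix s assume s: "0 < s \<and> s * 1 \<le> 1 \<and> s * A \<le> \<epsilon> / 2"
    have "\<forall>\<^sub>F t in at_right 0. 0 < t \<and> t * 2 \<le> r \<and> t * K \<le> \<epsilon> / 2 * s ^ lex_value B m a"
      using \<open>0 < \<epsilon>\<close> s r by (intro eventually_conj eventually_mult_le_at_right_0 eventually_at_right_less) auto
    then show "\<forall>\<^sub>F t in at_right 0. \<forall>S. finite S \<longrightarrow>
        (\<Sum>\<delta>\<in>S. norm (coeff u \<delta>) * weight t s B m \<delta>) \<le> \<epsilon> * weight t s B m a"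
      by (rule eventually_mono) (use main s in blast)
  qed
qed

lemma common_weight:
  fixes u :: "nat \<Rightarrow> 'a::real_normed_field mps"
  assumes u: "\<And>j. j < n \<Longrightarrow> conv m (u j)" and a: "\<And>j. j < n \<Longrightarrow> a j \<in> multi_indices m"
    and prec: "\<And>j \<delta>. j < n \<Longrightarrow> coeff (u j) \<delta> \<noteq> 0 \<Longrightarrow> prec m (a j) \<delta>" and "0 < \<epsilon>" "0 < r"
  shows "\<exists>t s B. 0 < t \<and> t \<le> r \<and> 0 < s \<and> s \<le> 1 \<and> 1 \<le> B \<and> (\<forall>j<n. \<forall>S. finite S \<longrightarrow>
           (\<Sum>\<delta>\<in>S. norm (coeff (u j) \<delta>) * weight t s B m \<delta>) \<le> \<epsilon> * weight t s B m (a j))"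
proof -
  define B where "B = Suc (\<Sum>j<n. deg m (a j))"
  have "deg m (a j) < B" if "j < n" for j
    using that member_le_sum[of j "{..<n}" "\<lambda>j. deg m (a j)"] by (simp add: B_def less_Suc_eq_le)
  then have "\<forall>\<^sub>F s in at_right 0. \<forall>j\<in>{..<n}. \<forall>\<^sub>F t in at_right 0. \<forall>S. finite S \<longrightarrow>
           (\<Sum>\<delta>\<in>S. norm (coeff (u j) \<delta>) * weight t s B m \<delta>) \<le> \<epsilon> * weight t s B m (a j)"
    using assms by (intro eventually_ball_finite ballI weight_dominates) auto
  moreover have "\<forall>\<^sub>F s in at_right (0::real). 0 < s \<and> s * 1 \<le> 1"
    by (intro eventually_conj eventually_mult_le_at_right_0 eventually_at_right_less) auto
  ultimately have "\<forall>\<^sub>F s in at_right 0. (0 < s \<and> s * 1 \<le> 1) \<and> (\<forall>j\<in>{..<n}. \<forall>\<^sub>F t in at_right 0. \<forall>S. finite S \<longrightarrow>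
           (\<Sum>\<delta>\<in>S. norm (coeff (u j) \<delta>) * weight t s B m \<delta>) \<le> \<epsilon> * weight t s B m (a j))"
    by (rule eventually_conj[rotated])
  then obtain s where s: "0 < s" "s \<le> 1" and "\<forall>j\<in>{..<n}. \<forall>\<^sub>F t in at_right 0. \<forall>S. finite S \<longrightarrow>
           (\<Sum>\<delta>\<in>S. norm (coeff (u j) \<delta>) * weight t s B m \<delta>) \<le> \<epsilon> * weight t s B m (a j)"
    using eventually_happens'[OF trivial_limit_at_right_real] by force
  then have "\<forall>\<^sub>F t in at_right 0. \<forall>j\<in>{..<n}. \<forall>S. finite S \<longrightarrow>
           (\<Sum>\<delta>\<in>S. norm (coeff (u j) \<delta>) * weight t s B m \<delta>) \<le> \<epsilon> * weight t s B m (a j)"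
    by (intro eventually_ball_finite) auto
  moreover have "\<forall>\<^sub>F t in at_right (0::real). 0 < t \<and> t * 1 \<le> r"
    using \<open>0 < r\<close> by (intro eventually_conj eventually_mult_le_at_right_0 eventually_at_right_less) auto
  ultimately have "\<forall>\<^sub>F t in at_right 0. (0 < t \<and> t * 1 \<le> r) \<and> (\<forall>j\<in>{..<n}. \<forall>S. finite S \<longrightarrow>
           (\<Sum>\<delta>\<in>S. norm (coeff (u j) \<delta>) * weight t s B m \<delta>) \<le> \<epsilon> * weight t s B m (a j))"
    by (rule eventually_conj[rotated])
  then obtain t where "0 < t" "t \<le> r" "\<forall>j\<in>{..<n}. \<forall>S. finite S \<longrightarrow>
           (\<Sum>\<delta>\<in>S. norm (coeff (u j) \<delta>) * weight t s B m \<delta>) \<le> \<epsilon> * weight t s B m (a j)"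
    using eventually_happens'[OF trivial_limit_at_right_real] by force
  moreover have "1 \<le> B" by (simp add: B_def)
  ultimately show ?thesis using s by (intro exI[of _ t] exI[of _ s] exI[of _ B]) auto
qed


text \<open>Distribute the monomials of a series \<open>F\<close> over the multiples of the leading monomials \<open>x\<^bsup>a\<^sub>j\<^esup>\<close>, each to
  the first \<open>j\<close> possible, and a rest \<open>r\<close>; so \<open>F\<close> is the sum of the \<open>x\<^bsup>a\<^sub>j\<^esup> q\<^sub>j\<close> and \<open>r\<close>. Then
  \<open>f = q\<^sub>1 h\<^sub>1 + \<dots> + q\<^sub>n h\<^sub>n + r\<close> is a fixed-point equation for \<open>F\<close>, namely \<open>F = f + \<Sum> q\<^sub>j (x\<^bsup>a\<^sub>j\<^esup> - h\<^sub>j)\<close>.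
  As \<open>x\<^bsup>a\<^sub>j\<^esup> - h\<^sub>j\<close> has only terms after \<open>a\<^sub>j\<close>, the equation is a recursion for the coefficients of \<open>F\<close>. At a
  polyradius where the leading monomials dominate, its right-hand side is \<open>f\<close> plus at most half of
  the supremum of the earlier terms, so the terms of \<open>F\<close> are bounded.\<close>

theorem division:
  fixes h :: "nat \<Rightarrow> 'a::real_normed_field mps"
  assumes divisors: "\<forall>j<n. conv m (h j) \<and> leads m (h j) (a j) \<and> coeff (h j) (a j) = 1"
    and f: "conv m f"
  shows "\<exists>q r. (\<forall>j. conv m (q j)) \<and> conv m r \<and> f = (\<Sum>j<n. q j * h j) + r \<and>
           (\<forall>j<n. \<forall>\<gamma>. coeff r (a j + \<gamma>) = 0) \<and>
           (\<forall>N. f \<in> ord_ge m N \<longrightarrow> r \<in> ord_ge m N \<and> (\<forall>j. q j \<in> ord_ge m (N - deg m (a j))))"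
proof -
  have h: "\<And>j. j < n \<Longrightarrow> conv m (h j)" "\<And>j. j < n \<Longrightarrow> leads m (h j) (a j)"
    and h1: "\<And>j. j < n \<Longrightarrow> coeff (h j) (a j) = 1"
    using divisors by simp_all
  define u where "u j = monom (a j) 1 - h j" for j
  have a: "a j \<in> multi_indices m" if "j < n" for j
    using h(1)[OF that] h1[OF that] by (metis conv_supp zero_neq_one)
  have u: "conv m (u j)" if "j < n" for j
    unfolding u_def using that by (intro conv_diff conv_monom a h)
  have u_prec: "prec m (a j) \<delta>" if "j < n" "coeff (u j) \<delta> \<noteq> 0" for j \<delta>
  proof -
    have "\<delta> \<noteq> a j" using that h1 by (auto simp: u_def)
    moreover from this have "\<not> prec m \<delta> (a j)"
      using that h(2) by (auto simp: u_def leads_def)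
    ultimately show ?thesis using prec_total by blast
  qed
  obtain r0 C where r0: "0 < r0" and C: "0 \<le> C" "\<And>\<alpha>. norm (coeff f \<alpha>) * r0 ^ deg m \<alpha> \<le> C"
    using conv_bound[OF f zero_less_one] by blast
  have "\<exists>t s B. 0 < t \<and> t \<le> r0 \<and> 0 < s \<and> s \<le> 1 \<and> 1 \<le> B \<and> (\<forall>j<n. \<forall>S. finite S \<longrightarrow>
      (\<Sum>\<delta>\<in>S. norm (coeff (u j) \<delta>) * weight t s B m \<delta>) \<le> 1 / (2 * real (Suc n)) * weight t s B m (a j))"
    by (rule common_weight) (use u a u_prec r0 in simp_all)
  then obtain t s B where tsB: "0 < t \<and> t \<le> r0 \<and> 0 < s \<and> s \<le> 1 \<and> 1 \<le> B \<and> (\<forall>j<n. \<forall>S. finite S \<longrightarrow>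
      (\<Sum>\<delta>\<in>S. norm (coeff (u j) \<delta>) * weight t s B m \<delta>) \<le> 1 / (2 * real (Suc n)) * weight t s B m (a j))"
    by (elim exE) (rule that)
  then have ts: "0 < t" "t \<le> r0" "0 < s" "s \<le> 1" "1 \<le> B"
    and dom: "\<And>j S. j < n \<Longrightarrow> finite S \<Longrightarrow>
      (\<Sum>\<delta>\<in>S. norm (coeff (u j) \<delta>) * weight t s B m \<delta>) \<le> 1 / (2 * real (Suc n)) * weight t s B m (a j)"
    by simp_all
  let ?w = "weight t s B m"
  have w: "0 < ?w \<alpha>" for \<alpha> using ts by (intro weight_pos)
  define chosen where "chosen j \<beta> \<longleftrightarrow> j < n \<and> (\<exists>\<gamma>. \<beta> = a j + \<gamma>) \<and> (\<forall>i<j. \<nexists>\<gamma>. \<beta> = a i + \<gamma>)" for j \<beta>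
  have chosen_unique: "chosen i \<beta> \<Longrightarrow> chosen j \<beta> \<Longrightarrow> i = j" for i j \<beta>
    unfolding chosen_def by (metis linorder_neqE_nat)
  have chosen_ex: "\<exists>i. chosen i (a j + \<gamma>)" if "j < n" for j \<gamma>
  proof -
    let ?P = "\<lambda>i. \<exists>\<gamma>'. a j + \<gamma> = a i + \<gamma>'"
    have "?P (LEAST i. ?P i)" by (rule LeastI[of ?P j]) blast
    moreover have "(LEAST i. ?P i) \<le> j" by (rule Least_le) blast
    ultimately have "chosen (LEAST i. ?P i) (a j + \<gamma>)"
      using that unfolding chosen_def by (blast dest: not_less_Least intro: le_less_trans)
    then show ?thesis ..
  qed
  \<comment> \<open>The right-hand side of the recursion. The conjunct \<open>coeff (u j) (snd p) \<noteq> 0\<close> makes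
    it depend on earlier coefficients only; outside the multi-indices in \<open>m\<close> variables, where the order is not
    well-founded, it is cut off.\<close>
  define G where "G F \<beta> = (if \<beta> \<in> multi_indices m then coeff f \<beta> +
      (\<Sum>j<n. \<Sum>p | fst p + snd p = \<beta>.
         if chosen j (a j + fst p) \<and> coeff (u j) (snd p) \<noteq> 0 then F (a j + fst p) * coeff (u j) (snd p) else 0)
      else 0)" for F \<beta>
  let ?R = "{(\<alpha>, \<beta>). \<alpha> \<in> multi_indices m \<and> \<beta> \<in> multi_indices m \<and> prec m \<alpha> \<beta>}"
  have smaller: "(a j + \<gamma>, \<beta>) \<in> ?R"
    if "\<beta> \<in> multi_indices m" "\<gamma> + \<delta> = \<beta>" "j < n" "coeff (u j) \<delta> \<noteq> 0" for j \<beta> \<gamma> \<delta>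
    using that a[of j] prec_add_right[OF u_prec[OF that(3,4)], of \<gamma>] by (auto simp: add.commute)
  have "adm_wf ?R G"
    unfolding adm_wf_def
  proof (intro allI impI)
    fix F F' :: "(nat \<Rightarrow>\<^sub>0 nat) \<Rightarrow> 'a" and \<beta> assume *: "\<forall>z. (z, \<beta>) \<in> ?R \<longrightarrow> F z = F' z"
    have "F (a j + fst p) = F' (a j + fst p)"
      if "\<beta> \<in> multi_indices m" "fst p + snd p = \<beta>" "j < n" "coeff (u j) (snd p) \<noteq> 0" for j p
      using * smaller[OF that] by blast
    then have teq: "(if chosen j (a j + fst p) \<and> coeff (u j) (snd p) \<noteq> 0 then F (a j + fst p) * coeff (u j) (snd p) else 0)
        = (if chosen j (a j + fst p) \<and> coeff (u j) (snd p) \<noteq> 0 then F' (a j + fst p) * coeff (u j) (snd p) else 0)"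
      if "\<beta> \<in> multi_indices m" "fst p + snd p = \<beta>" "j < n" for j p
      using that by (cases "coeff (u j) (snd p) = 0") simp_all
    have "G F \<beta> = G F' \<beta>" if True: "\<beta> \<in> multi_indices m"
      unfolding G_def if_P[OF True]
      by (rule arg_cong[of _ _ "(+) (coeff f \<beta>)"], rule sum.cong[OF refl], rule sum.cong[OF refl], rule teq[OF True])
        (simp_all only: mem_Collect_eq lessThan_iff)
    moreover have "G F \<beta> = G F' \<beta>" if False: "\<beta> \<notin> multi_indices m"
      unfolding G_def if_not_P[OF False] ..
    ultimately show "G F \<beta> = G F' \<beta>" by (rule case_split)
  qed
  then have fixpoint: "wfrec ?R G = G (wfrec ?R G)"
    by (rule wfrec_fixpoint[OF wf_prec])
  define F where "F = wfrec ?R G"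
  have F: "F = G F" unfolding F_def by (rule fixpoint)
  have F_supp: "F \<beta> = 0" if "\<beta> \<notin> multi_indices m" for \<beta>
    using that by (subst F) (simp add: G_def)
  \<comment> \<open>By \<open>dom\<close> the recursive part contributes at most \<open>n / (2 * Suc n)\<close> times \<open>2 * C\<close>, and \<open>f\<close> itself at most \<open>C\<close>.\<close>
  have F_bound: "norm (F \<beta>) * ?w \<beta> \<le> 2 * C" for \<beta>
  proof (induction \<beta> rule: wf_induct_rule[OF wf_prec[of m]])
    case (1 \<beta>)
    show ?case
    proof (cases "\<beta> \<in> multi_indices m")
      case False
      then show ?thesis using F_supp C by simp
    next
      case True
      let ?S = "{p. fst p + snd p = \<beta>}"
      have fin: "finite ?S"
        using finite_splittings[of \<beta>] by (simp add: case_prod_unfold)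
      let ?T = "\<lambda>j p. if chosen j (a j + fst p) \<and> coeff (u j) (snd p) \<noteq> 0
                    then F (a j + fst p) * coeff (u j) (snd p) else 0"
      have "(\<Sum>p\<in>?S. norm (?T j p) * ?w \<beta>) \<le> C / real (Suc n)" if "j < n" for j
      proof -
        have "norm (?T j p) * ?w \<beta> \<le> 2 * C / ?w (a j) * (norm (coeff (u j) (snd p)) * ?w (snd p))"
          if "p \<in> ?S" for p
        proof (cases "chosen j (a j + fst p) \<and> coeff (u j) (snd p) \<noteq> 0")
          case T: True
          have \<beta>: "?w \<beta> = ?w (fst p) * ?w (snd p)"
            using that by (auto simp: weight_add)
          have "norm (F (a j + fst p)) * (?w (a j) * ?w (fst p)) \<le> 2 * C"
            using 1[of "a j + fst p"] smaller[OF True _ \<open>j < n\<close>, of "fst p" "snd p"] that T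
            by (simp add: weight_add)
          then have "norm (F (a j + fst p)) * ?w (fst p) \<le> 2 * C / ?w (a j)"
            using w[of "a j"] by (simp add: field_simps)
          then have "norm (F (a j + fst p)) * ?w (fst p) * (norm (coeff (u j) (snd p)) * ?w (snd p))
              \<le> 2 * C / ?w (a j) * (norm (coeff (u j) (snd p)) * ?w (snd p))"
            using w[of "snd p"] by (intro mult_right_mono) auto
          then show ?thesis using T by (simp add: \<beta> norm_mult mult_ac)
        next
          case False
          then have "?T j p = 0" by simp
          then show ?thesis using C w[of "a j"] w[of "snd p"] by simp
        qed
        then have "(\<Sum>p\<in>?S. norm (?T j p) * ?w \<beta>)
            \<le> (\<Sum>p\<in>?S. 2 * C / ?w (a j) * (norm (coeff (u j) (snd p)) * ?w (snd p)))"
          by (rule sum_mono)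
        also have "\<dots> = 2 * C / ?w (a j) * (\<Sum>\<delta>\<in>snd ` ?S. norm (coeff (u j) \<delta>) * ?w \<delta>)"
        proof -
          have "inj_on snd ?S" by (auto simp: inj_on_def)
          then show ?thesis by (simp add: sum.reindex sum_distrib_left)
        qed
        also have "\<dots> \<le> 2 * C / ?w (a j) * (1 / (2 * real (Suc n)) * ?w (a j))"
          using C w[of "a j"] dom[OF \<open>j < n\<close> finite_imageI[OF fin]] by (intro mult_left_mono) auto
        also have "\<dots> = C / real (Suc n)"
          using w[of "a j"] by (simp add: field_simps del: of_nat_Suc)
        finally show ?thesis .
      qed
      then have "(\<Sum>j<n. \<Sum>p\<in>?S. norm (?T j p) * ?w \<beta>) \<le> (\<Sum>j<n. C / real (Suc n))"
        by (intro sum_mono) auto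
      also have "\<dots> \<le> C"
        using C by (simp add: field_simps)
      finally have *: "(\<Sum>j<n. \<Sum>p\<in>?S. norm (?T j p) * ?w \<beta>) \<le> C" .
      have "norm (coeff f \<beta>) * ?w \<beta> \<le> norm (coeff f \<beta>) * r0 ^ deg m \<beta>"
        using ts by (intro mult_left_mono order_trans[OF weight_le] power_mono) auto
      then have f': "norm (coeff f \<beta>) * ?w \<beta> \<le> C"
        using C(2) order_trans by blast
      have F_eq: "F \<beta> = coeff f \<beta> + (\<Sum>j<n. \<Sum>p\<in>?S. ?T j p)"
        using True by (subst F) (simp add: G_def)
      have "norm (F \<beta>) \<le> norm (coeff f \<beta>) + (\<Sum>j<n. \<Sum>p\<in>?S. norm (?T j p))"
        unfolding F_eq
        by (intro order_trans[OF norm_triangle_ineq] add_mono order_refl order_trans[OF norm_sum] sum_mono norm_sum)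
      then have "norm (F \<beta>) * ?w \<beta> \<le> (norm (coeff f \<beta>) + (\<Sum>j<n. \<Sum>p\<in>?S. norm (?T j p))) * ?w \<beta>"
        using w[of \<beta>] by (intro mult_right_mono) auto
      also have "\<dots> = norm (coeff f \<beta>) * ?w \<beta> + (\<Sum>j<n. \<Sum>p\<in>?S. norm (?T j p) * ?w \<beta>)"
        by (simp add: distrib_right sum_distrib_right)
      finally show ?thesis using * f' by linarith
    qed
  qed
  define q where "q j = Mps (\<lambda>\<gamma>. if chosen j (a j + \<gamma>) then F (a j + \<gamma>) else 0)" for j
  define r where "r = Mps (\<lambda>\<beta>. if \<exists>j. chosen j \<beta> then 0 else F \<beta>)"
  have q_coeff: "coeff (q j) \<gamma> = (if chosen j (a j + \<gamma>) then F (a j + \<gamma>) else 0)" for j \<gamma>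
    by (simp add: q_def Mps_inverse)
  have r_coeff: "coeff r \<beta> = (if \<exists>j. chosen j \<beta> then 0 else F \<beta>)" for \<beta>
    by (simp add: r_def Mps_inverse)
  have q_conv: "conv m (q j)" for j
  proof (rule conv_weightI[OF _ ts(1,3,4,5), where C = "2 * C / ?w (a j)"])
    fix \<gamma>
    show "\<gamma> \<notin> multi_indices m \<Longrightarrow> coeff (q j) \<gamma> = 0"
      using F_supp by (simp add: q_coeff)
    have "norm (coeff (q j) \<gamma>) * ?w (a j + \<gamma>) \<le> 2 * C"
      using F_bound[of "a j + \<gamma>"] C by (simp add: q_coeff)
    then show "norm (coeff (q j) \<gamma>) * ?w \<gamma> \<le> 2 * C / ?w (a j)"
      using w[of "a j"] by (simp add: weight_add field_simps)
  qed
  have r_conv: "conv m r"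
    by (rule conv_weightI[OF _ ts(1,3,4,5), where C = "2 * C"])
      (use F_supp F_bound C in \<open>auto simp: r_coeff\<close>)
  have F_split: "(\<Sum>j<n. coeff (monom (a j) 1 * q j) \<beta>) + coeff r \<beta> = F \<beta>" for \<beta>
  proof -
    have *: "coeff (monom (a j) 1 * q j) \<beta> = (if chosen j \<beta> then F \<beta> else 0)" for j
    proof (cases "\<exists>\<gamma>. \<beta> = a j + \<gamma>")
      case True
      then show ?thesis by (auto simp: q_coeff)
    next
      case False
      then show ?thesis by (auto simp: chosen_def coeff_monom_mult_eq_0)
    qed
    show ?thesis
    proof (cases "\<exists>j. chosen j \<beta>")
      case True
      then obtain i where i: "chosen i \<beta>" by blast
      then have "i < n" by (simp add: chosen_def)
      have "(\<Sum>j<n. if chosen j \<beta> then F \<beta> else 0) = (\<Sum>j<n. if j = i then F \<beta> else 0)"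
        using i chosen_unique by (intro sum.cong) auto
      then show ?thesis using True \<open>i < n\<close> by (simp add: * r_coeff)
    next
      case False
      then show ?thesis by (simp add: * r_coeff)
    qed
  qed
  have F_rec: "F \<beta> = coeff f \<beta> + (\<Sum>j<n. coeff (q j * u j) \<beta>)" for \<beta>
  proof (cases "\<beta> \<in> multi_indices m")
    case True
    have "coeff (q j * u j) \<beta> = (\<Sum>p | fst p + snd p = \<beta>.
         if chosen j (a j + fst p) \<and> coeff (u j) (snd p) \<noteq> 0 then F (a j + fst p) * coeff (u j) (snd p) else 0)" for j
      unfolding coeff_mult case_prod_unfold by (rule sum.cong) (auto simp: q_coeff)
    then show ?thesis using True by (subst F) (simp add: G_def)
  next
    case False
    then have "coeff (q j * u j) \<beta> = 0" if "j < n" for j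
      using that by (intro conv_supp[OF conv_mult[OF q_conv u]])
    then show ?thesis using False F_supp conv_supp[OF f] by simp
  qed
  have "f = (\<Sum>j<n. q j * h j) + r"
  proof (rule mps_eqI)
    fix \<beta>
    have "q j * h j = monom (a j) 1 * q j - q j * u j" for j
      by (simp add: u_def algebra_simps)
    then have "coeff ((\<Sum>j<n. q j * h j) + r) \<beta>
        = ((\<Sum>j<n. coeff (monom (a j) 1 * q j) \<beta>) + coeff r \<beta>) - (\<Sum>j<n. coeff (q j * u j) \<beta>)"
      by (simp add: sum_subtractf)
    also have "\<dots> = coeff f \<beta>"
      unfolding F_split using F_rec[of \<beta>] by simp
    finally show "coeff f \<beta> = coeff ((\<Sum>j<n. q j * h j) + r) \<beta>" ..
  qed
  moreover have "coeff r (a j + \<gamma>) = 0" if "j < n" for j \<gamma>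
    using chosen_ex[OF that] by (simp add: r_coeff)
  moreover have "r \<in> ord_ge m N \<and> (\<forall>j. q j \<in> ord_ge m (N - deg m (a j)))" if N: "f \<in> ord_ge m N" for N
  proof -
    have F0: "deg m \<beta> < N \<longrightarrow> F \<beta> = 0" for \<beta>
    proof (induction \<beta> rule: wf_induct_rule[OF wf_prec[of m]])
      case (1 \<beta>)
      show ?case
      proof
        assume deg: "deg m \<beta> < N"
        have "F (a j + fst p) = 0"
          if "\<beta> \<in> multi_indices m" "fst p + snd p = \<beta>" "j < n" "coeff (u j) (snd p) \<noteq> 0" for j p
          using 1[OF smaller[OF that]] smaller[OF that] deg by (auto dest: prec_deg_le)
        then have "(\<Sum>j<n. \<Sum>p | fst p + snd p = \<beta>.
            if chosen j (a j + fst p) \<and> coeff (u j) (snd p) \<noteq> 0 then F (a j + fst p) * coeff (u j) (snd p) else 0) = 0"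
          if "\<beta> \<in> multi_indices m"
          using that by (intro sum.neutral ballI) simp_all
        then have "G F \<beta> = coeff f \<beta>"
          unfolding G_def using conv_supp[OF f, of \<beta>] by simp
        then show "F \<beta> = 0"
          using N deg by (subst F) (simp add: ord_ge_def)
      qed
    qed
    show ?thesis
      using r_conv q_conv F0 by (auto simp: ord_ge_def r_coeff q_coeff)
  qed
  ultimately show ?thesis
    using q_conv r_conv by blast
qed

section \<open>Standard bases\<close>

text \<open>A decreasing sequence of natural numbers is eventually constant.\<close>

lemma mono_subseq_nat:
  fixes f :: "nat \<Rightarrow> nat"
  obtains \<phi> :: "nat \<Rightarrow> nat" where "strict_mono \<phi>" "mono (\<lambda>n. f (\<phi> n))"
proof -
  obtain \<phi> :: "nat \<Rightarrow> nat" where \<phi>: "strict_mono \<phi>" "monoseq (\<lambda>n. f (\<phi> n))"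
    using seq_monosub[of f] by blast
  show ?thesis
  proof (cases "mono (\<lambda>n. f (\<phi> n))")
    case False
    then have dec: "\<And>i j. i \<le> j \<Longrightarrow> f (\<phi> j) \<le> f (\<phi> i)"
      using \<phi>(2) by (auto simp: monoseq_def mono_def)
    obtain n where n: "\<And>k. f (\<phi> n) \<le> f (\<phi> k)"
      using ex_has_least_nat[of "\<lambda>_. True" 0 "\<lambda>k. f (\<phi> k)"] by auto
    have "f (\<phi> (n + k)) = f (\<phi> n)" for k
      using dec[of n "n + k"] n[of "n + k"] by simp
    then show ?thesis
      using \<phi>(1) by (intro that[of "\<lambda>k. \<phi> (n + k)"]) (auto simp: strict_mono_def mono_def)
  qed (use \<phi> that in blast)
qed

lemma multi_index_le_imp_add:
  "(\<And>i. lookup \<beta> i \<le> lookup \<alpha> i) \<Longrightarrow> \<exists>\<gamma>. \<alpha> = \<beta> + (\<gamma> :: nat \<Rightarrow>\<^sub>0 nat)"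
  by (rule exI[of _ "\<alpha> - \<beta>"], rule poly_mapping_eqI) (simp add: lookup_add lookup_minus)

lemma mono_subseq_multi_indices:
  fixes e :: "nat \<Rightarrow> nat \<Rightarrow>\<^sub>0 nat"
  obtains \<phi> :: "nat \<Rightarrow> nat" where "strict_mono \<phi>" "\<And>i. i < m \<Longrightarrow> mono (\<lambda>n. lookup (e (\<phi> n)) i)"
proof -
  have "\<exists>\<phi>::nat \<Rightarrow> nat. strict_mono \<phi> \<and> (\<forall>i<m. mono (\<lambda>n. lookup (e (\<phi> n)) i))"
  proof (induction m)
    case 0
    show ?case by (rule exI[of _ id]) (simp add: strict_mono_def)
  next
    case (Suc m)
    then obtain \<phi> :: "nat \<Rightarrow> nat" where \<phi>: "strict_mono \<phi>" "\<And>i. i < m \<Longrightarrow> mono (\<lambda>n. lookup (e (\<phi> n)) i)" by blast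
    obtain \<psi> :: "nat \<Rightarrow> nat" where \<psi>: "strict_mono \<psi>" "mono (\<lambda>n. lookup (e (\<phi> (\<psi> n))) m)"
      by (rule mono_subseq_nat[of "\<lambda>n. lookup (e (\<phi> n)) m"]) (rule that)
    have "mono (\<lambda>n. lookup (e (\<phi> (\<psi> n))) i)" if "i < Suc m" for i
      using that \<psi> \<phi>(2)[of i] strict_mono_mono[OF \<psi>(1)] by (cases "i = m") (auto simp: mono_def)
    then show ?case
      using strict_mono_o[OF \<phi>(1) \<psi>(1)] by (intro exI[of _ "\<phi> \<circ> \<psi>"]) (auto simp: o_def)
  qed
  then show ?thesis using that by blast
qed

text \<open>Dickson's lemma: an infinite antichain would have a subsequence that increases in every coordinate.\<close>

lemma dickson:
  assumes A: "A \<subseteq> multi_indices m"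
  shows "\<exists>B\<subseteq>A. finite B \<and> (\<forall>\<alpha>\<in>A. \<exists>\<beta>\<in>B. \<exists>\<gamma>. \<alpha> = \<beta> + \<gamma>)"
proof -
  define B where "B = {\<beta> \<in> A. \<forall>\<alpha>\<in>A. \<forall>\<gamma>. \<beta> = \<alpha> + \<gamma> \<longrightarrow> \<alpha> = \<beta>}"
  have "finite B"
  proof (rule ccontr)
    assume "infinite B"
    then obtain e :: "nat \<Rightarrow> nat \<Rightarrow>\<^sub>0 nat" where e: "inj e" "range e \<subseteq> B"
      using infinite_countable_subset by blast
    obtain \<phi> :: "nat \<Rightarrow> nat" where \<phi>: "strict_mono \<phi>" "\<And>i. i < m \<Longrightarrow> mono (\<lambda>n. lookup (e (\<phi> n)) i)"
      by (rule mono_subseq_multi_indices[of m e]) (rule that)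
    have eA: "e n \<in> A" "e n \<in> B" for n using e(2) by (auto simp: B_def)
    have "lookup (e (\<phi> 0)) i \<le> lookup (e (\<phi> 1)) i" for i
    proof (cases "i < m")
      case True
      then show ?thesis using \<phi>(2) by (simp add: mono_def)
    next
      case False
      then show ?thesis using multi_indicesD[of "e (\<phi> 0)" m i] eA A by (simp add: subset_iff)
    qed
    then obtain \<gamma> where "e (\<phi> 1) = e (\<phi> 0) + \<gamma>"
      using multi_index_le_imp_add by blast
    then have "e (\<phi> 0) = e (\<phi> 1)"
      using eA(2)[of "\<phi> 1"] eA(1)[of "\<phi> 0"] unfolding B_def by blast
    then show False
      using e(1) \<phi>(1) by (metis injD strict_mono_eq zero_neq_one)
  qed
  moreover have "\<alpha> \<in> A \<Longrightarrow> \<exists>\<beta>\<in>B. \<exists>\<gamma>. \<alpha> = \<beta> + \<gamma>" for \<alpha>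
  proof (induction \<alpha> rule: measure_induct_rule[where f = "deg m"])
    case (less \<alpha>)
    show ?case
    proof (cases "\<alpha> \<in> B")
      case True
      then show ?thesis by (intro bexI[of _ \<alpha>] exI[of _ 0]) auto
    next
      case False
      then obtain \<beta> \<gamma> where \<beta>: "\<beta> \<in> A" "\<alpha> = \<beta> + \<gamma>" "\<beta> \<noteq> \<alpha>"
        using less.prems unfolding B_def by blast
      then have "\<gamma> \<in> multi_indices m" "\<gamma> \<noteq> 0"
        using less.prems A by auto
      then have "deg m \<beta> < deg m \<alpha>"
        using deg_zero_imp[of \<gamma> m] \<beta>(2) by auto
      then show ?thesis
        using less.IH[OF _ \<beta>(1)] \<beta>(2) by (metis add.assoc)
    qed
  qed
  moreover have "B \<subseteq> A" by (auto simp: B_def)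
  ultimately show ?thesis by blast
qed

definition cps_ideal :: "nat \<Rightarrow> 'a::real_normed_field mps set \<Rightarrow> bool" where
  "cps_ideal m I \<longleftrightarrow> I \<subseteq> {f. conv m f} \<and> 0 \<in> I \<and> (\<forall>f\<in>I. \<forall>g\<in>I. f + g \<in> I) \<and>
     (\<forall>f\<in>I. \<forall>g. conv m g \<longrightarrow> g * f \<in> I)"

lemma cps_ideal_conv: "cps_ideal m I \<Longrightarrow> f \<in> I \<Longrightarrow> conv m f"
  by (auto simp: cps_ideal_def)

lemma cps_ideal_mult: "cps_ideal m I \<Longrightarrow> f \<in> I \<Longrightarrow> conv m g \<Longrightarrow> g * f \<in> I"
  by (auto simp: cps_ideal_def)

lemma cps_ideal_add: "cps_ideal m I \<Longrightarrow> f \<in> I \<Longrightarrow> g \<in> I \<Longrightarrow> f + g \<in> I"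
  by (auto simp: cps_ideal_def)

lemma cps_ideal_uminus: "cps_ideal m I \<Longrightarrow> f \<in> I \<Longrightarrow> - f \<in> I"
  using cps_ideal_mult[of m I f "- 1"] by (simp add: conv_uminus)

lemma cps_ideal_diff: "cps_ideal m I \<Longrightarrow> f \<in> I \<Longrightarrow> g \<in> I \<Longrightarrow> f - g \<in> I"
  using cps_ideal_add[of m I f "- g"] cps_ideal_uminus by force

lemma cps_ideal_sum: "cps_ideal m I \<Longrightarrow> (\<And>i. i \<in> A \<Longrightarrow> f i \<in> I) \<Longrightarrow> sum f A \<in> I"
  by (induction A rule: infinite_finite_induct) (auto simp: cps_ideal_def)

lemma leads_exists:
  assumes "conv m f" "f \<noteq> 0"
  shows "\<exists>\<alpha>. leads m f \<alpha>"
proof -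
  let ?S = "{\<alpha>. coeff f \<alpha> \<noteq> 0}"
  obtain \<beta> where "\<beta> \<in> ?S" using assms(2) mps_eqI[of f 0] by auto
  then obtain \<alpha> where \<alpha>: "\<alpha> \<in> ?S"
    "\<And>\<beta>. (\<beta>, \<alpha>) \<in> {(\<alpha>, \<beta>). \<alpha> \<in> multi_indices m \<and> \<beta> \<in> multi_indices m \<and> prec m \<alpha> \<beta>} \<Longrightarrow> \<beta> \<notin> ?S"
    by (rule wfE_min[OF wf_prec[of m]]) (rule that)
  have "\<not> prec m \<beta> \<alpha>" if "coeff f \<beta> \<noteq> 0" for \<beta>
    using \<alpha> that conv_supp[OF assms(1)] by auto
  then show ?thesis using \<alpha>(1) unfolding leads_def by blast
qed

lemma leads_multi_indices: "conv m f \<Longrightarrow> leads m f \<alpha> \<Longrightarrow> \<alpha> \<in> multi_indices m"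
  by (auto simp: leads_def dest: conv_supp)

lemma leads_ord_ge: "conv m f \<Longrightarrow> leads m f \<alpha> \<Longrightarrow> f \<in> ord_ge m (deg m \<alpha>)"
  by (auto simp: leads_def ord_ge_def prec_def)

lemma leads_cong:
  assumes "leads m f \<alpha>" "f - g \<in> ord_ge m (Suc (deg m \<alpha>))"
  shows "leads m g \<alpha>"
proof -
  have "coeff f \<beta> = coeff g \<beta>" if "deg m \<beta> \<le> deg m \<alpha>" for \<beta>
    using assms(2) that by (simp add: ord_ge_def)
  then show ?thesis
    using assms(1) unfolding leads_def by (metis prec_deg_le order_refl)
qed

text \<open>Dickson's lemma, applied to the set of leading exponents.\<close>

lemma standard_basis_exists:
  assumes I: "cps_ideal m (I :: 'a::real_normed_field mps set)"
  shows "\<exists>(n::nat) h a. (\<forall>j<n. h j \<in> I \<and> leads m (h j) (a j) \<and> coeff (h j) (a j) = 1) \<and>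
           (\<forall>f\<in>I. \<forall>\<alpha>. leads m f \<alpha> \<longrightarrow> (\<exists>j<n. \<exists>\<gamma>. \<alpha> = a j + \<gamma>))"
proof -
  let ?A = "{\<alpha>. \<exists>f\<in>I. leads m f \<alpha>}"
  have "?A \<subseteq> multi_indices m"
    using leads_multi_indices cps_ideal_conv[OF I] by blast
  from dickson[OF this] obtain B where B: "B \<subseteq> ?A" "finite B"
    "\<forall>\<alpha>\<in>?A. \<exists>\<beta>\<in>B. \<exists>\<gamma>. \<alpha> = \<beta> + \<gamma>" by (elim exE conjE) (rule that)
  obtain xs where xs: "set xs = B" using finite_list[OF B(2)] by blast
  have "\<exists>h. h \<in> I \<and> leads m h \<alpha> \<and> coeff h \<alpha> = 1" if \<alpha>: "\<alpha> \<in> B" for \<alpha>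
  proof -
    obtain f where f: "f \<in> I" "leads m f \<alpha>" using B(1) \<alpha> by blast
    let ?h = "monom 0 (1 / coeff f \<alpha>) * f"
    have "?h \<in> I" using f I by (intro cps_ideal_mult conv_monom) auto
    moreover have "leads m ?h \<alpha>" "coeff ?h \<alpha> = 1" using f by (auto simp: leads_def)
    ultimately show ?thesis by blast
  qed
  then obtain H where H: "\<And>\<alpha>. \<alpha> \<in> B \<Longrightarrow> H \<alpha> \<in> I \<and> leads m (H \<alpha>) \<alpha> \<and> coeff (H \<alpha>) \<alpha> = 1"
    using bchoice[of B "\<lambda>\<alpha> h. h \<in> I \<and> leads m h \<alpha> \<and> coeff h \<alpha> = 1"] by blast
  show ?thesis
  proof (rule exI[of _ "length xs"], rule exI[of _ "H \<circ> (!) xs"], rule exI[of _ "(!) xs"],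
      intro conjI allI impI ballI)
    fix j assume "j < length xs"
    then have "xs ! j \<in> B" using xs by auto
    then show "(H \<circ> (!) xs) j \<in> I" "leads m ((H \<circ> (!) xs) j) (xs ! j)" "coeff ((H \<circ> (!) xs) j) (xs ! j) = 1"
      using H by auto
  next
    fix f \<alpha> assume "f \<in> I" "leads m f \<alpha>"
    then obtain \<beta> \<gamma> where "\<beta> \<in> B" "\<alpha> = \<beta> + \<gamma>" using B(3) by blast
    then show "\<exists>j<length xs. \<exists>\<gamma>. \<alpha> = xs ! j + \<gamma>"
      using xs by (metis in_set_conv_nth)
  qed
qed

text \<open>Division by a standard basis. The remainder of a limit point of the ideal agrees to any given
  order with an element of the ideal, so its leading exponent would be one of the ideal, and these do
  not occur in remainders. The degrees of the finitely many leading exponents bound the loss of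
  order in the quotients, which gives the Artin-Rees property.\<close>

theorem ideal_finite_generation:
  assumes I: "cps_ideal m (I :: 'a::real_normed_field mps set)"
  shows "\<exists>(n::nat) h c. (\<forall>j<n. h j \<in> I) \<and> (\<forall>f. conv m f \<longrightarrow> (\<forall>N. \<exists>g\<in>I. f - g \<in> ord_ge m N) \<longrightarrow>
           (\<exists>q. (\<forall>j. conv m (q j)) \<and> f = (\<Sum>j<n. q j * h j) \<and>
             (\<forall>N. f \<in> ord_ge m N \<longrightarrow> (\<forall>j<n. q j \<in> ord_ge m (N - c)))))"
proof -
  obtain n :: nat and h a where h': "\<forall>j<n. h j \<in> I \<and> leads m (h j) (a j) \<and> coeff (h j) (a j) = 1"
    and gen: "\<forall>f\<in>I. \<forall>\<alpha>. leads m f \<alpha> \<longrightarrow> (\<exists>j<n. \<exists>\<gamma>. \<alpha> = a j + \<gamma>)"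
    using standard_basis_exists[OF I] by (elim exE conjE) (rule that)
  then have h: "\<And>j. j < n \<Longrightarrow> h j \<in> I" "\<And>j. j < n \<Longrightarrow> leads m (h j) (a j)"
      "\<And>j. j < n \<Longrightarrow> coeff (h j) (a j) = 1"
    by simp_all
  define c where "c = (\<Sum>j<n. deg m (a j))"
  have c: "deg m (a j) \<le> c" if "j < n" for j
    unfolding c_def using that by (intro member_le_sum) auto
  show ?thesis
  proof (rule exI[of _ n], rule exI[of _ h], rule exI[of _ c], intro conjI allI impI)
    show "h j \<in> I" if "j < n" for j by (rule h(1)[OF that])
    fix f assume f: "conv m f" "\<forall>N. \<exists>g\<in>I. f - g \<in> ord_ge m N"
    have "\<forall>j<n. conv m (h j) \<and> leads m (h j) (a j) \<and> coeff (h j) (a j) = 1"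
      using h' cps_ideal_conv[OF I] by blast
    from division[OF this f(1)]
    obtain q r where q: "\<forall>j. conv m (q j)" and r: "conv m r" and eq: "f = (\<Sum>j<n. q j * h j) + r"
      and r0: "\<forall>j<n. \<forall>\<gamma>. coeff r (a j + \<gamma>) = 0"
      and ord': "\<forall>N. f \<in> ord_ge m N \<longrightarrow> r \<in> ord_ge m N \<and> (\<forall>j. q j \<in> ord_ge m (N - deg m (a j)))"
      by (elim exE conjE) (rule that)
    have ord: "q j \<in> ord_ge m (N - c)" if "f \<in> ord_ge m N" "j < n" for N j
      using ord' that c[of j] by (meson diff_le_mono2 ord_ge_antimono)
    have "r = 0"
    proof (rule ccontr)
      assume "r \<noteq> 0"
      then obtain \<alpha> where \<alpha>: "leads m r \<alpha>" using leads_exists[OF r] by blast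
      obtain g where g: "g \<in> I" "f - g \<in> ord_ge m (Suc (deg m \<alpha>))" using f(2) by blast
      let ?g = "g - (\<Sum>j<n. q j * h j)"
      have "?g \<in> I" using g h q by (intro cps_ideal_diff[OF I] cps_ideal_sum[OF I] cps_ideal_mult[OF I]) auto
      moreover have "r - ?g \<in> ord_ge m (Suc (deg m \<alpha>))" using g(2) eq by (simp add: algebra_simps)
      ultimately obtain j \<gamma> where "j < n" "\<alpha> = a j + \<gamma>"
        using gen leads_cong[OF \<alpha>, of ?g] by blast
      then show False using r0 \<alpha> by (simp add: leads_def)
    qed
    then show "\<exists>q. (\<forall>j. conv m (q j)) \<and> f = (\<Sum>j<n. q j * h j) \<and>
             (\<forall>N. f \<in> ord_ge m N \<longrightarrow> (\<forall>j<n. q j \<in> ord_ge m (N - c)))"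
      using q eq ord by (intro exI[of _ q]) auto
  qed
qed

corollary ideal_closed:
  assumes I: "cps_ideal m I" and f: "conv m f" "\<And>N. \<exists>g\<in>I. f - g \<in> ord_ge m N"
  shows "f \<in> I"
proof -
  obtain n :: nat and h c where h: "\<forall>j<n. h j \<in> I" and gen: "\<forall>f. conv m f \<longrightarrow> (\<forall>N. \<exists>g\<in>I. f - g \<in> ord_ge m N) \<longrightarrow>
           (\<exists>q. (\<forall>j. conv m (q j)) \<and> f = (\<Sum>j<n. q j * h j) \<and>
             (\<forall>N. f \<in> ord_ge m N \<longrightarrow> (\<forall>j<n. q j \<in> ord_ge m (N - c))))"
    using ideal_finite_generation[OF I] by (elim exE conjE) (rule that)
  obtain q where "\<forall>j. conv m (q j)" "f = (\<Sum>j<n. q j * h j)"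
    using gen[rule_format, OF f] by blast
  then show ?thesis
    using h by (auto intro!: cps_ideal_sum[OF I] cps_ideal_mult[OF I])
qed

lemma not_prec_zero: "\<not> prec m \<beta> 0"
  by (auto simp: prec_def less_poly_mapping.rep_eq less_fun_def)

text \<open>Division by a series with the leading exponent \<open>0\<close> has no remainder.\<close>

corollary unit_if_const_term:
  fixes f :: "'a::real_normed_field mps"
  assumes f: "conv m f" "coeff f 0 \<noteq> 0"
  shows "\<exists>g. conv m g \<and> g * f = 1"
proof -
  let ?c = "monom 0 (1 / coeff f 0)"
  have "\<exists>q r. (\<forall>j. conv m (q j)) \<and> conv m r \<and> 1 = (\<Sum>j<1. q j * (?c * f)) + r \<and>
           (\<forall>j<(1::nat). \<forall>\<gamma>. coeff r (0 + \<gamma>) = 0) \<and>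
           (\<forall>N. (1 :: 'a mps) \<in> ord_ge m N \<longrightarrow> r \<in> ord_ge m N \<and> (\<forall>j::nat. q j \<in> ord_ge m (N - deg m 0)))"
    by (rule division[where h = "\<lambda>_. ?c * f" and a = "\<lambda>_. 0" and n = 1 and f = 1 and m = m])
      (use f not_prec_zero in \<open>auto simp: leads_def intro!: conv_mult conv_monom\<close>)
  then obtain q r where q: "\<forall>j::nat. conv m (q j)" "1 = (\<Sum>j<1. q j * (?c * f)) + r"
      "\<forall>j<1::nat. \<forall>\<gamma>. coeff r (0 + \<gamma>) = 0"
    by (elim exE conjE) (rule that)
  moreover have "r = 0" using q(3) by (intro mps_eqI) simp
  ultimately show ?thesis
    by (intro exI[of _ "q 0 * ?c"]) (auto simp: mult_ac intro!: conv_mult conv_monom)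
qed

definition var :: "nat \<Rightarrow> 'a::comm_ring_1 mps" where
  "var i = monom (Poly_Mapping.single i 1) 1"

lemma deg_single [simp]: "i < m \<Longrightarrow> deg m (Poly_Mapping.single i k) = k"
  by (simp add: deg_def lookup_single when_def)

lemma single_multi_indices: "i < m \<Longrightarrow> Poly_Mapping.single i k \<in> multi_indices m"
  by (rule multi_indicesI) (auto simp: lookup_single when_def)

lemma var_ord_ge: "i < m \<Longrightarrow> var i \<in> ord_ge m 1"
  unfolding ord_ge_def var_def by (auto intro!: conv_monom single_multi_indices)

text \<open>Division by the variables can leave only a constant as remainder.\<close>

corollary ord_ge_Suc_decompose:
  assumes f: "f \<in> ord_ge m (Suc N)"
  shows "\<exists>q. (\<forall>i. q i \<in> ord_ge m N) \<and> f = (\<Sum>i<m. q i * var i)"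
proof -
  let ?e = "\<lambda>i. Poly_Mapping.single i (1::nat)"
  have "\<exists>q r. (\<forall>j. conv m (q j)) \<and> conv m r \<and> f = (\<Sum>j<m. q j * var j) + r \<and>
           (\<forall>j<m. \<forall>\<gamma>. coeff r (?e j + \<gamma>) = 0) \<and>
           (\<forall>N. f \<in> ord_ge m N \<longrightarrow> r \<in> ord_ge m N \<and> (\<forall>j. q j \<in> ord_ge m (N - deg m (?e j))))"
    by (rule division[where h = var and a = ?e])
      (use f in \<open>auto simp: leads_def var_def ord_ge_conv intro!: conv_monom single_multi_indices split: if_splits\<close>)
  then obtain q r where r: "conv m r" "f = (\<Sum>j<m. q j * var j) + r"
    and r0: "\<forall>j<m. \<forall>\<gamma>. coeff r (?e j + \<gamma>) = 0"
    and ord': "\<forall>N. f \<in> ord_ge m N \<longrightarrow> r \<in> ord_ge m N \<and> (\<forall>j. q j \<in> ord_ge m (N - deg m (?e j)))"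
    by (elim exE conjE) (rule that)
  have ord: "r \<in> ord_ge m (Suc N)" "q i \<in> ord_ge m (Suc N - deg m (?e i))" for i
    using ord' f by blast+
  have "r = 0"
  proof (rule mps_eqI)
    fix \<alpha>
    show "coeff r \<alpha> = coeff 0 \<alpha>"
    proof (cases "\<alpha> \<in> multi_indices m \<and> \<alpha> \<noteq> 0")
      case True
      then obtain i where i: "lookup \<alpha> i \<noteq> 0" by (metis poly_mapping_eqI lookup_zero)
      then have "i < m" using True multi_indicesD not_less by blast
      moreover obtain \<gamma> where "\<alpha> = ?e i + \<gamma>"
      proof -
        have "lookup (?e i) k \<le> lookup \<alpha> k" for k
          using i by (auto simp: lookup_single when_def)
        then show ?thesis using multi_index_le_imp_add[of "?e i" \<alpha>] that by blast
      qed
      ultimately show ?thesis using r0 by simp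
    next
      case False
      then show ?thesis using conv_supp[OF r(1)] ord(1) by (auto simp: ord_ge_def)
    qed
  qed
  moreover have "q i \<in> ord_ge m N" if "i < m" for i
    using ord(2)[of i] that by simp
  ultimately show ?thesis
    using r(2) by (intro exI[of _ "\<lambda>i. if i < m then q i else 0"]) auto
qed

section \<open>Perturbation of regular sequences\<close>

definition gen :: "nat \<Rightarrow> nat \<Rightarrow> (nat \<Rightarrow> 'a::real_normed_field mps) \<Rightarrow> 'a mps set" where
  "gen m i f = {(\<Sum>l<i. c l * f l) | c. \<forall>l<i. conv m (c l)}"

text \<open>Regularity of a sequence without the condition that the ideal is proper. At \<open>l = 0\<close> the ideal is
  zero, and the condition says that \<open>f 0\<close> is a non-zerodivisor.\<close>

definition reg :: "nat \<Rightarrow> nat \<Rightarrow> (nat \<Rightarrow> 'a::real_normed_field mps) \<Rightarrow> bool" where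
  "reg m i f \<longleftrightarrow> (\<forall>l<i. \<forall>b. conv m b \<longrightarrow> b * f l \<in> gen m l f \<longrightarrow> b \<in> gen m l f)"

definition artin_rees :: "nat \<Rightarrow> nat \<Rightarrow> nat \<Rightarrow> (nat \<Rightarrow> 'a::real_normed_field mps) \<Rightarrow> bool" where
  "artin_rees m i k f \<longleftrightarrow> (\<forall>N h. h \<in> gen m i f \<longrightarrow> h \<in> ord_ge m N \<longrightarrow>
     (\<exists>c. (\<forall>l<i. c l \<in> ord_ge m (N - k)) \<and> h = (\<Sum>l<i. c l * f l)))"

definition same_jets ::
    "nat \<Rightarrow> nat \<Rightarrow> nat \<Rightarrow> (nat \<Rightarrow> 'a::real_normed_field mps) \<Rightarrow> (nat \<Rightarrow> 'a mps) \<Rightarrow> bool" where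
  "same_jets m \<mu> i f g \<longleftrightarrow> (\<forall>l<i. conv m (f l) \<and> conv m (g l) \<and> g l - f l \<in> ord_ge m (Suc \<mu>))"

lemma genI: "(\<And>l. l < i \<Longrightarrow> conv m (c l)) \<Longrightarrow> (\<Sum>l<i. c l * f l) \<in> gen m i f"
  by (auto simp: gen_def)

lemma genE:
  assumes "h \<in> gen m i f"
  obtains c where "\<forall>l<i. conv m (c l)" "h = (\<Sum>l<i. c l * f l)"
  using assms by (auto simp: gen_def)

lemma gen_ideal:
  fixes f :: "nat \<Rightarrow> 'a::real_normed_field mps"
  assumes "\<forall>l<i. conv m (f l)"
  shows "cps_ideal m (gen m i f)"
  unfolding cps_ideal_def
proof (intro conjI subsetI ballI allI impI)
  fix x assume "x \<in> gen m i f"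
  then show "x \<in> {f. conv m f}"
    using assms by (elim genE) (auto intro!: conv_sum conv_mult)
next
  show "0 \<in> gen m i f" using genI[of i m "\<lambda>_. 0" f] by simp
next
  fix x y assume "x \<in> gen m i f" "y \<in> gen m i f"
  then obtain c d where c: "\<forall>l<i. conv m (c l)" "x = (\<Sum>l<i. c l * f l)"
    and d: "\<forall>l<i. conv m (d l)" "y = (\<Sum>l<i. d l * f l)"
    by (elim genE) (rule that)
  have "x + y = (\<Sum>l<i. (c l + d l) * f l)"
    by (simp add: c d distrib_right sum.distrib)
  also have "\<dots> \<in> gen m i f"
    by (rule genI) (use c d in \<open>auto intro: conv_add\<close>)
  finally show "x + y \<in> gen m i f" .
next
  fix x g assume "x \<in> gen m i f" and g: "conv m (g :: 'a mps)"
  then obtain c where c: "\<forall>l<i. conv m (c l)" "x = (\<Sum>l<i. c l * f l)"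
    by (elim genE) (rule that)
  have "g * x = (\<Sum>l<i. (g * c l) * f l)"
    by (simp add: c sum_distrib_left mult.assoc)
  also have "\<dots> \<in> gen m i f"
    by (rule genI) (use c g in \<open>auto intro: conv_mult\<close>)
  finally show "g * x \<in> gen m i f" .
qed

lemma gen_SucI: "y \<in> gen m i f \<Longrightarrow> conv m b \<Longrightarrow> y + b * f i \<in> gen m (Suc i) f"
proof (elim genE)
  fix c assume "conv m b" and c: "\<forall>l<i. conv m (c l)" "y = (\<Sum>l<i. c l * f l)"
  then have "y + b * f i = (\<Sum>l<Suc i. (c(i := b)) l * f l)"
    by simp
  also have "\<dots> \<in> gen m (Suc i) f"
    by (rule genI) (use c \<open>conv m b\<close> in \<open>auto simp: less_Suc_eq\<close>)
  finally show ?thesis .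
qed

lemma same_jets_sym: "same_jets m \<mu> i f g \<Longrightarrow> same_jets m \<mu> i g f"
  unfolding same_jets_def using ord_ge_uminus by (metis minus_diff_eq)

lemma same_jets_refl: "\<forall>l<i. conv m (f l) \<Longrightarrow> same_jets m \<mu> i f f"
  by (simp add: same_jets_def)

lemma same_jets_mono: "same_jets m \<mu> i f g \<Longrightarrow> \<nu> \<le> \<mu> \<Longrightarrow> j \<le> i \<Longrightarrow> same_jets m \<nu> j f g"
  unfolding same_jets_def by (meson Suc_le_mono less_le_trans ord_ge_antimono)

text \<open>The standard basis is expressed through the generators once and for all, which does not cost any order.\<close>

lemma artin_rees_exists:
  assumes f: "\<forall>l<i. conv m (f l)"
  shows "\<exists>k. artin_rees m i k f"
proof -
  note I = gen_ideal[OF f]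
  obtain n :: nat and h c where h: "\<forall>j<n. h j \<in> gen m i f"
    and fin: "\<forall>x. conv m x \<longrightarrow> (\<forall>N. \<exists>g\<in>gen m i f. x - g \<in> ord_ge m N) \<longrightarrow>
           (\<exists>q. (\<forall>j. conv m (q j)) \<and> x = (\<Sum>j<n. q j * h j) \<and>
             (\<forall>N. x \<in> ord_ge m N \<longrightarrow> (\<forall>j<n. q j \<in> ord_ge m (N - c))))"
    using ideal_finite_generation[OF I] by (elim exE conjE) (rule that)
  have "\<forall>j\<in>{..<n}. \<exists>d. (\<forall>l<i. conv m (d l)) \<and> h j = (\<Sum>l<i. d l * f l)"
    using h by (auto simp: gen_def)
  then obtain d where d: "\<forall>j\<in>{..<n}. (\<forall>l<i. conv m (d j l)) \<and> h j = (\<Sum>l<i. d j l * f l)"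
    using bchoice[of "{..<n}" "\<lambda>j d. (\<forall>l<i. conv m (d l)) \<and> h j = (\<Sum>l<i. d l * f l)"] by blast
  have "artin_rees m i c f"
    unfolding artin_rees_def
  proof (intro allI impI)
    fix N x assume x: "x \<in> gen m i f" "x \<in> ord_ge m N"
    have "\<forall>N. \<exists>g\<in>gen m i f. x - g \<in> ord_ge m N" using x(1) by (intro allI bexI[of _ x]) auto
    then obtain q where q: "x = (\<Sum>j<n. q j * h j)"
      "\<forall>N. x \<in> ord_ge m N \<longrightarrow> (\<forall>j<n. q j \<in> ord_ge m (N - c))"
      using fin cps_ideal_conv[OF I x(1)] by blast
    have "x = (\<Sum>j<n. \<Sum>l<i. q j * d j l * f l)"
      using q(1) d by (simp add: sum_distrib_left mult.assoc)
    also have "\<dots> = (\<Sum>l<i. (\<Sum>j<n. q j * d j l) * f l)"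
      by (subst sum.swap) (simp add: sum_distrib_right)
    finally have "x = (\<Sum>l<i. (\<Sum>j<n. q j * d j l) * f l)" .
    moreover have "(\<Sum>j<n. q j * d j l) \<in> ord_ge m (N - c)" if "l < i" for l
      using q(2) x(2) d that by (intro ord_ge_sum ord_ge_mult_right) auto
    ultimately show "\<exists>e. (\<forall>l<i. e l \<in> ord_ge m (N - c)) \<and> x = (\<Sum>l<i. e l * f l)"
      by (intro exI[of _ "\<lambda>l. \<Sum>j<n. q j * d j l"]) blast
  qed
  then show ?thesis ..
qed

text \<open>The error in replacing the generators is the product of coefficients of order \<open>e - k\<close> with
  differences of order \<open>\<mu> + 1\<close>. For \<open>k \<le> \<mu>\<close> it has a higher order than the element itself, so that both
  have the same initial form.\<close>

lemma artin_rees_transport: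
  assumes ar: "artin_rees m i k f" and jets: "same_jets m \<mu> i f g"
    and x: "x \<in> gen m i f" "x \<in> ord_ge m e"
  shows "\<exists>y\<in>gen m i g. x - y \<in> ord_ge m (e - k + Suc \<mu>)"
proof -
  obtain c where c: "\<forall>l<i. c l \<in> ord_ge m (e - k)" "x = (\<Sum>l<i. c l * f l)"
    using ar x unfolding artin_rees_def by blast
  have "(\<Sum>l<i. c l * g l) \<in> gen m i g"
    using c(1) by (intro genI) (auto dest: ord_ge_conv)
  moreover have "x - (\<Sum>l<i. c l * g l) = (\<Sum>l<i. c l * (f l - g l))"
    by (simp add: c(2) sum_subtractf right_diff_distrib)
  moreover have "(\<Sum>l<i. c l * (f l - g l)) \<in> ord_ge m (e - k + Suc \<mu>)"
    using c(1) same_jets_sym[OF jets] by (intro ord_ge_sum ord_ge_mult) (auto simp: same_jets_def)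
  ultimately show ?thesis by metis
qed

text \<open>The constant \<open>c\<close> and the jet order \<open>\<mu>\<close> do not depend on \<open>g\<close>. That is what the induction on \<open>i\<close> needs:
  it moves elements between the ideals of \<open>f\<close> and of \<open>g\<close> an unbounded number of times, always with the
  same loss of order. The new constant is \<open>c + c1 + 1\<close>, where \<open>c1\<close> belongs to the fixed ideal of
  the first \<open>i + 1\<close> members of \<open>f\<close>.\<close>

theorem regular_perturbation:
  fixes f :: "nat \<Rightarrow> 'a::real_normed_field mps"
  assumes f: "\<forall>l<k. conv m (f l)" and reg: "reg m k f" and "i \<le> k"
  shows "\<exists>c \<mu>. \<forall>g. same_jets m \<mu> i f g \<longrightarrow> artin_rees m i c g \<and> reg m i g"
  using \<open>i \<le> k\<close>
proof (induction i)
  case 0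
  show ?case by (auto simp: artin_rees_def reg_def gen_def)
next
  case (Suc i)
  then obtain c \<mu>\<^sub>0 where IH: "\<forall>g. same_jets m \<mu>\<^sub>0 i f g \<longrightarrow> artin_rees m i c g \<and> reg m i g"
    by auto
  have fi: "conv m (f i)" "\<forall>l<i. conv m (f l)" "\<forall>l<Suc i. conv m (f l)"
    using f Suc.prems by auto
  note If = gen_ideal[OF fi(2)]
  have arf: "artin_rees m i c f" using IH same_jets_refl[OF fi(2)] by blast
  obtain c1 where c1: "artin_rees m (Suc i) c1 f" using artin_rees_exists[OF fi(3)] by blast
  \<comment> \<open>Rewriting \<open>b * f i - y\<close> with coefficients of order \<open>n\<close> gives a second coefficient \<open>d i\<close> of \<open>f i\<close>, and \<open>b - d i\<close>
    multiplies \<open>f i\<close> into the previous ideal.\<close>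
  have colon_f: "\<exists>y'\<in>gen m i f. b - y' \<in> ord_ge m n"
    if b: "conv m b" and y: "y \<in> gen m i f" and ord: "b * f i - y \<in> ord_ge m (n + c1)" for b y n
  proof -
    have "b * f i - y \<in> gen m (Suc i) f"
      using gen_SucI[OF cps_ideal_uminus[OF If y] b] by simp
    then obtain d where d: "\<forall>l<Suc i. d l \<in> ord_ge m n" "b * f i - y = (\<Sum>l<Suc i. d l * f l)"
      using c1 ord unfolding artin_rees_def by (metis add_diff_cancel_right')
    have "(b - d i) * f i = y + (\<Sum>l<i. d l * f l)"
      using d(2) by (simp add: algebra_simps)
    moreover have "(\<Sum>l<i. d l * f l) \<in> gen m i f"
      using d(1) by (intro genI) (meson less_SucI ord_ge_conv)
    ultimately have "(b - d i) * f i \<in> gen m i f"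
      using cps_ideal_add[OF If y] by simp
    moreover have "conv m (b - d i)" using b d(1) by (auto intro: conv_diff ord_ge_conv)
    ultimately have "b - d i \<in> gen m i f"
      using reg Suc.prems by (auto simp: reg_def)
    then show ?thesis using d(1) by (intro bexI[of _ "b - d i"]) auto
  qed
  \<comment> \<open>The summand \<open>c\<close> pays for a transport between the ideals of \<open>f\<close> and \<open>g\<close>, and \<open>c1\<close> for the use of \<open>colon_f\<close>.\<close>
  define \<mu> where "\<mu> = max \<mu>\<^sub>0 (c + c1)"
  have main: "artin_rees m (Suc i) (Suc c1 + c) g \<and> reg m (Suc i) g" if g: "same_jets m \<mu> (Suc i) f g" for g
  proof -
    have gc: "\<forall>l<Suc i. conv m (g l)" "\<forall>l<i. conv m (g l)" "conv m (g i)"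
      and gi: "g i - f i \<in> ord_ge m (Suc \<mu>)"
      using g by (auto simp: same_jets_def)
    note Ig = gen_ideal[OF gc(2)]
    have jets: "same_jets m \<mu>\<^sub>0 i f g" "same_jets m \<mu> i f g"
      using same_jets_mono[OF g] by (auto simp: \<mu>_def)
    have arg: "artin_rees m i c g" and regg: "reg m i g" using IH jets(1) by auto
    \<comment> \<open>The analogue of \<open>colon_f\<close>, where the order \<open>e\<close> of \<open>b\<close> modulo the ideal is raised one by one.\<close>
    have colon_g: "\<exists>y'\<in>gen m i g. b - y' \<in> ord_ge m e"
      if b: "conv m b" and y: "y \<in> gen m i g" and ord: "b * g i - y \<in> ord_ge m (n + Suc c1)" and "e \<le> n"
      for b y n e
      using \<open>e \<le> n\<close>
    proof (induction e)
      case 0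
      then show ?case using b cps_ideal_def[of m "gen m i g"] Ig by (intro bexI[of _ 0]) auto
    next
      case (Suc e)
      then obtain y' where y': "y' \<in> gen m i g" "b - y' \<in> ord_ge m e" by auto
      define b' where "b' = b - y'"
      define y2 where "y2 = y - g i * y'"
      have b': "b' \<in> ord_ge m e" "conv m b'" using y'(2) by (auto simp: b'_def dest: ord_ge_conv)
      have y2: "y2 \<in> gen m i g"
        unfolding y2_def by (intro cps_ideal_diff[OF Ig] cps_ideal_mult[OF Ig] y y' gc)
      have ord2: "b' * g i - y2 \<in> ord_ge m (n + Suc c1)"
        using ord by (simp add: b'_def y2_def algebra_simps)
      have "y2 = b' * g i - (b' * g i - y2)" by simp
      also have "\<dots> \<in> ord_ge m e"
        by (intro ord_ge_diff ord_ge_mult_right b' gc ord_ge_antimono[OF ord2]) (use Suc.prems in auto)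
      finally obtain y3 where y3: "y3 \<in> gen m i f" "y2 - y3 \<in> ord_ge m (e - c + Suc \<mu>)"
        using artin_rees_transport[OF arg same_jets_sym[OF jets(2)] y2] by blast
      \<comment> \<open>Three errors between \<open>b' * f i\<close> and \<open>y3\<close>: from \<open>f i\<close> to \<open>g i\<close>, from \<open>b' * g i\<close> to the ideal of \<open>g\<close>, and from
        there to the ideal of \<open>f\<close>.\<close>
      have "b' * (f i - g i) \<in> ord_ge m (e + Suc \<mu>)"
        using gi ord_ge_uminus[OF gi] by (intro ord_ge_mult b') simp
      then have "b' * (f i - g i) \<in> ord_ge m (Suc e + c1)"
        by (rule ord_ge_antimono) (auto simp: \<mu>_def)
      moreover have "b' * g i - y2 \<in> ord_ge m (Suc e + c1)"
        by (rule ord_ge_antimono[OF ord2]) (use Suc.prems in auto)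
      moreover have "y2 - y3 \<in> ord_ge m (Suc e + c1)"
        by (rule ord_ge_antimono[OF y3(2)]) (auto simp: \<mu>_def)
      ultimately have "b' * (f i - g i) + (b' * g i - y2) + (y2 - y3) \<in> ord_ge m (Suc e + c1)"
        by (intro ord_ge_add)
      then have "b' * f i - y3 \<in> ord_ge m (Suc e + c1)"
        by (simp add: algebra_simps)
      then obtain y4 where y4: "y4 \<in> gen m i f" "b' - y4 \<in> ord_ge m (Suc e)"
        using colon_f[OF b'(2) y3(1)] by blast
      have "y4 = b' - (b' - y4)" by simp
      also have "\<dots> \<in> ord_ge m e"
        by (intro ord_ge_diff b' ord_ge_antimono[OF y4(2)]) simp
      finally obtain y5 where y5: "y5 \<in> gen m i g" "y4 - y5 \<in> ord_ge m (e - c + Suc \<mu>)"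
        using artin_rees_transport[OF arf jets(2) y4(1)] by blast
      have "y4 - y5 \<in> ord_ge m (Suc e)"
        by (rule ord_ge_antimono[OF y5(2)]) (auto simp: \<mu>_def)
      then have "(b' - y4) + (y4 - y5) \<in> ord_ge m (Suc e)"
        using y4(2) by (intro ord_ge_add)
      then have "b - (y' + y5) \<in> ord_ge m (Suc e)"
        by (simp add: b'_def algebra_simps)
      then show ?case using cps_ideal_add[OF Ig y'(1) y5(1)] by blast
    qed
    have "b \<in> gen m i g" if b: "conv m b" "b * g i \<in> gen m i g" for b
    proof (rule ideal_closed[OF Ig b(1)])
      fix N
      show "\<exists>y\<in>gen m i g. b - y \<in> ord_ge m N"
        using colon_g[OF b, of N N] by simp
    qed
    then have "reg m (Suc i) g"
      using regg by (auto simp: reg_def less_Suc_eq)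
    moreover have "artin_rees m (Suc i) (Suc c1 + c) g"
      unfolding artin_rees_def
    proof (intro allI impI)
      fix N h assume h: "h \<in> gen m (Suc i) g" "h \<in> ord_ge m N"
      then obtain d where d: "\<forall>l<Suc i. conv m (d l)" "h = (\<Sum>l<Suc i. d l * g l)"
        by (elim genE) (rule that)
      show "\<exists>d. (\<forall>l<Suc i. d l \<in> ord_ge m (N - (Suc c1 + c))) \<and> h = (\<Sum>l<Suc i. d l * g l)"
      proof (cases "N \<le> Suc c1")
        case True
        then show ?thesis using d by (intro exI[of _ d]) simp
      next
        case False
        define n where "n = N - Suc c1"
        have N: "N = n + Suc c1" using False by (simp add: n_def)
        define y where "y = (\<Sum>l<i. d l * g l)"
        have y: "y \<in> gen m i g" unfolding y_def using d(1) by (intro genI) auto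
        have hy: "h = y + d i * g i" using d(2) by (simp add: y_def)
        have "d i * g i - (- y) \<in> ord_ge m (n + Suc c1)"
          using h(2) by (simp add: hy N add.commute)
        then obtain y' where y': "y' \<in> gen m i g" "d i - y' \<in> ord_ge m n"
          using colon_g[OF _ cps_ideal_uminus[OF Ig y], of "d i" n n] d(1) by auto
        have "h - (d i - y') * g i \<in> ord_ge m n"
          by (intro ord_ge_diff ord_ge_mult_right y' gc ord_ge_antimono[OF h(2)]) (auto simp: N)
        moreover have "h - (d i - y') * g i = y + g i * y'"
          by (simp add: hy algebra_simps)
        moreover have "y + g i * y' \<in> gen m i g"
          by (intro cps_ideal_add[OF Ig] cps_ideal_mult[OF Ig] y y' gc)
        ultimately obtain e where e: "\<forall>l<i. e l \<in> ord_ge m (n - c)" "h - (d i - y') * g i = (\<Sum>l<i. e l * g l)"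
          using arg unfolding artin_rees_def by metis
        have "h = (\<Sum>l<Suc i. (e(i := d i - y')) l * g l)"
          using e(2) by (simp add: algebra_simps)
        moreover have "(e(i := d i - y')) l \<in> ord_ge m (N - (Suc c1 + c))" if "l < Suc i" for l
          using that e(1) ord_ge_antimono[OF y'(2), of "n - c"] by (auto simp: N less_Suc_eq)
        ultimately show ?thesis by blast
      qed
    qed
    ultimately show ?thesis by blast
  qed
  then show ?case by blast
qed

text \<open>The transport is applied in both directions, which is possible because \<open>f\<close> itself belongs to the
  sequences with a uniform constant.\<close>

corollary leading_exponents_perturbation:
  fixes f :: "nat \<Rightarrow> 'a::real_normed_field mps"
  assumes f: "\<forall>l<k. conv m (f l)" and reg: "reg m k f"
  shows "\<exists>\<mu>. \<forall>g. same_jets m \<mu> k f g \<longrightarrow> reg m k g \<and>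
           (\<forall>\<alpha>. (\<exists>x\<in>gen m k g. leads m x \<alpha>) \<longleftrightarrow> (\<exists>x\<in>gen m k f. leads m x \<alpha>))"
proof -
  obtain c \<mu>\<^sub>0 where *: "\<forall>g. same_jets m \<mu>\<^sub>0 k f g \<longrightarrow> artin_rees m k c g \<and> reg m k g"
    using regular_perturbation[OF f reg order_refl] by blast
  define \<mu> where "\<mu> = max \<mu>\<^sub>0 c"
  have transport: "\<exists>y\<in>gen m k g'. leads m y \<alpha>"
    if ar: "artin_rees m k c g" and jets: "same_jets m \<mu> k g g'" and x: "x \<in> gen m k g" "leads m x \<alpha>"
    for g g' :: "nat \<Rightarrow> 'a mps" and x \<alpha>
  proof -
    have "\<forall>l<k. conv m (g l)" using jets by (auto simp: same_jets_def)
    then have "x \<in> ord_ge m (deg m \<alpha>)"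
      using leads_ord_ge x cps_ideal_conv[OF gen_ideal] by blast
    then obtain y where y: "y \<in> gen m k g'" "x - y \<in> ord_ge m (deg m \<alpha> - c + Suc \<mu>)"
      using artin_rees_transport[OF ar jets x(1)] by blast
    have "x - y \<in> ord_ge m (Suc (deg m \<alpha>))"
      by (rule ord_ge_antimono[OF y(2)]) (auto simp: \<mu>_def)
    then show ?thesis using leads_cong[OF x(2)] y(1) by blast
  qed
  have "reg m k g \<and> (\<forall>\<alpha>. (\<exists>x\<in>gen m k g. leads m x \<alpha>) \<longleftrightarrow> (\<exists>x\<in>gen m k f. leads m x \<alpha>))"
    if g: "same_jets m \<mu> k f g" for g
  proof -
    have "same_jets m \<mu>\<^sub>0 k f g" using same_jets_mono[OF g] by (simp add: \<mu>_def)
    then have "artin_rees m k c g" "reg m k g" "artin_rees m k c f"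
      using * same_jets_refl[OF f] by auto
    then show ?thesis
      using transport g same_jets_sym[OF g] by blast
  qed
  then show ?thesis by blast
qed

section \<open>The ring of convergent power series\<close>

lemma norm_monomial_at:
  fixes p :: "nat \<Rightarrow> 'a::real_normed_field"
  assumes "\<alpha> \<in> multi_indices m"
  shows "norm (monomial_at p \<alpha>) = (\<Prod>i<m. norm (p i) ^ lookup \<alpha> i)"
proof -
  have "norm (monomial_at p \<alpha>) = (\<Prod>i\<in>keys \<alpha>. norm (p i) ^ lookup \<alpha> i)"
    by (simp add: monomial_at_def prod_norm[symmetric] norm_power)
  also have "\<dots> = (\<Prod>i<m. norm (p i) ^ lookup \<alpha> i)"
    by (rule prod.mono_neutral_left) (use assms in \<open>auto simp: multi_indices_def in_keys_iff\<close>)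
  finally show ?thesis .
qed

text \<open>Abel's lemma: summability at one point without zero coordinates bounds the terms there, and
  bounded terms at a radius give absolute convergence at half that radius.\<close>

lemma convergent_pseries_iff: "convergent_pseries m (coeff f) \<longleftrightarrow> conv m f"
proof
  assume *: "convergent_pseries m (coeff f)"
  then obtain r where r: "r > 0"
    and s: "\<forall>p\<in>polydisc m r. (\<lambda>\<alpha>. coeff f \<alpha> * monomial_at p \<alpha>) abs_summable_on multi_indices m"
    unfolding convergent_pseries_def by blast
  define p :: "nat \<Rightarrow> 'a" where "p i = (if i < m then of_real (r / 2) else 0)" for i
  have "p \<in> polydisc m r" using r by (simp add: polydisc_def affine_space_def p_def)
  with s have s: "(\<lambda>\<alpha>. norm (coeff f \<alpha> * monomial_at p \<alpha>)) summable_on multi_indices m" by blast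
  show "conv m f"
  proof (rule convI)
    show "0 < r / 2" using r by simp
    show "\<And>\<alpha>. \<alpha> \<notin> multi_indices m \<Longrightarrow> coeff f \<alpha> = 0" using * by (simp add: convergent_pseries_def)
    fix \<alpha> assume \<alpha>: "\<alpha> \<in> multi_indices m"
    have "norm (coeff f \<alpha>) * (r / 2) ^ deg m \<alpha> = (\<Sum>\<alpha>\<in>{\<alpha>}. norm (coeff f \<alpha> * monomial_at p \<alpha>))"
      using r by (simp add: norm_mult norm_monomial_at[OF \<alpha>] p_def deg_def power_sum)
    also have "\<dots> \<le> infsum (\<lambda>\<alpha>. norm (coeff f \<alpha> * monomial_at p \<alpha>)) (multi_indices m)"
      using \<alpha> by (intro finite_sum_le_infsum s) auto
    finally show "norm (coeff f \<alpha>) * (r / 2) ^ deg m \<alpha>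
        \<le> infsum (\<lambda>\<alpha>. norm (coeff f \<alpha> * monomial_at p \<alpha>)) (multi_indices m)" .
  qed
next
  assume f: "conv m f"
  obtain r C where r: "0 < r" and C: "\<forall>\<alpha>. norm (coeff f \<alpha>) * r ^ deg m \<alpha> \<le> C"
    using conv_bound[OF f zero_less_one] by blast
  have "(\<lambda>\<alpha>. coeff f \<alpha> * monomial_at p \<alpha>) abs_summable_on multi_indices m"
    if p: "p \<in> polydisc m (r / 2)" for p :: "nat \<Rightarrow> 'a"
  proof (rule nonneg_bdd_above_summable_on)
    have "sum (\<lambda>\<alpha>. norm (coeff f \<alpha> * monomial_at p \<alpha>)) S \<le> C * 2 ^ m"
      if S: "S \<subseteq> multi_indices m" "finite S" for S
    proof -
      have "sum (\<lambda>\<alpha>. norm (coeff f \<alpha> * monomial_at p \<alpha>)) S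
          \<le> (\<Sum>\<alpha>\<in>S. norm (coeff f \<alpha>) * (r / 2) ^ deg m \<alpha>)"
      proof (rule sum_mono)
        fix \<alpha> assume "\<alpha> \<in> S"
        then have \<alpha>: "\<alpha> \<in> multi_indices m" using S by blast
        have "norm (monomial_at p \<alpha>) \<le> (\<Prod>i<m. (r / 2) ^ lookup \<alpha> i)"
          unfolding norm_monomial_at[OF \<alpha>]
          using p by (intro prod_mono) (auto simp: polydisc_def intro!: power_mono intro: less_imp_le)
        then show "norm (coeff f \<alpha> * monomial_at p \<alpha>) \<le> norm (coeff f \<alpha>) * (r / 2) ^ deg m \<alpha>"
          by (simp add: norm_mult deg_def power_sum mult_left_mono)
      qed
      also have "\<dots> \<le> C * 2 ^ m"
        using S r C by (intro sum_coeff_le) auto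
      finally show ?thesis .
    qed
    then show "bdd_above (sum (\<lambda>\<alpha>. norm (coeff f \<alpha> * monomial_at p \<alpha>)) ` {F. F \<subseteq> multi_indices m \<and> finite F})"
      by (intro bdd_aboveI[of _ "C * 2 ^ m"]) auto
  qed simp
  then show "convergent_pseries m (coeff f)"
    using conv_supp[OF f] r unfolding convergent_pseries_def
    by (intro conjI allI impI exI[of _ "r / 2"]) auto
qed

lemma coeff_Mps [simp]: "coeff (Mps x) = x"
  by (simp add: Mps_inverse)

lemma Mps_coeff [simp]: "Mps (coeff f) = f"
  by (rule coeff_inverse)

lemma coeff_image_iff [simp]: "coeff f \<in> coeff ` I \<longleftrightarrow> f \<in> I"
  by (auto simp: coeff_inject)

lemma cps_carrier: "carrier (cps m) = coeff ` {f. conv m f}"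
proof -
  have "x \<in> coeff ` {f. conv m f} \<longleftrightarrow> convergent_pseries m x" for x :: "'a pseries"
    using convergent_pseries_iff[of m "Mps x"] by (metis (mono_tags) coeff_Mps image_iff mem_Collect_eq Mps_coeff)
  then show ?thesis by (auto simp: cps_def)
qed

lemma coeff_in_cps [simp]: "coeff f \<in> carrier (cps m) \<longleftrightarrow> conv m f"
  by (simp add: cps_def convergent_pseries_iff)

lemma cps_add [simp]: "coeff f \<oplus>\<^bsub>cps m\<^esub> coeff g = coeff (f + g)"
  by (simp add: cps_def plus_mps.rep_eq)

lemma cps_mult [simp]: "coeff f \<otimes>\<^bsub>cps m\<^esub> coeff g = coeff (f * g)"
  by (simp add: cps_def times_mps.rep_eq)

lemma cps_zero: "\<zero>\<^bsub>cps m\<^esub> = coeff 0"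
  by (simp add: cps_def zero_mps.rep_eq)

lemma cps_one: "\<one>\<^bsub>cps m\<^esub> = coeff 1"
  by (simp add: cps_def one_mps.rep_eq)

lemma cps_cring: "cring (cps m :: 'a::{real_normed_field,banach} pseries ring)"
proof (rule cringI[OF abelian_groupI comm_monoidI])
  fix x assume "x \<in> carrier (cps m :: 'a pseries ring)"
  then obtain f where "conv m f" "x = coeff f" by (auto simp: cps_carrier)
  then show "\<exists>y\<in>carrier (cps m). y \<oplus>\<^bsub>cps m\<^esub> x = \<zero>\<^bsub>cps m\<^esub>"
    by (intro bexI[of _ "coeff (- f)"]) (auto simp: cps_zero conv_uminus)
qed (auto simp: cps_carrier cps_zero cps_one conv_add conv_mult algebra_simps)

lemma cps_uminus: "conv m f \<Longrightarrow> \<ominus>\<^bsub>cps m\<^esub> coeff f = coeff (- f)"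
proof -
  assume f: "conv m f"
  interpret cring "cps m :: 'a pseries ring" by (rule cps_cring)
  show ?thesis
    by (rule minus_equality) (use f in \<open>auto simp: cps_zero conv_uminus\<close>)
qed

lemma cps_minus: "conv m f \<Longrightarrow> conv m g \<Longrightarrow> coeff f \<ominus>\<^bsub>cps m\<^esub> coeff g = coeff (f - g)"
  by (simp add: a_minus_def cps_uminus)

lemma cps_ideal_ideal:
  assumes I: "cps_ideal m (I :: 'a::{real_normed_field,banach} mps set)"
  shows "ideal (coeff ` I) (cps m)"
proof -
  interpret R: cring "cps m :: 'a pseries ring" by (rule cps_cring)
  show ?thesis
  proof (rule idealI)
    show "subgroup (coeff ` I) (add_monoid (cps m))"
    proof (rule group.subgroupI[OF R.a_group])
      show "coeff ` I \<noteq> {}" using I by (auto simp: cps_ideal_def)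
      fix x assume "x \<in> coeff ` I"
      then obtain f where f: "f \<in> I" "x = coeff f" by blast
      then have "inv\<^bsub>add_monoid (cps m)\<^esub> x = coeff (- f)"
        using cps_uminus[OF cps_ideal_conv[OF I f(1)]] by (simp add: a_inv_def)
      then show "inv\<^bsub>add_monoid (cps m)\<^esub> x \<in> coeff ` I"
        using cps_ideal_uminus[OF I f(1)] by simp
    qed (use cps_ideal_conv[OF I] cps_ideal_add[OF I] in auto)
  qed (use R.ring_axioms cps_ideal_mult[OF I] in \<open>auto simp: cps_carrier mult.commute\<close>)
qed

lemma coset_eq_iff:
  fixes I :: "'a::{real_normed_field,banach} mps set"
  assumes "cps_ideal m I" "conv m f" "conv m g"
  shows "coeff ` I +>\<^bsub>cps m\<^esub> coeff f = coeff ` I +>\<^bsub>cps m\<^esub> coeff g \<longleftrightarrow> f - g \<in> I"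
proof -
  interpret R: cring "cps m :: 'a pseries ring" by (rule cps_cring)
  show ?thesis
    using R.quotient_eq_iff_same_a_r_cos[OF cps_ideal_ideal[OF assms(1)], of "coeff f" "coeff g"] assms(2,3)
    by (simp add: cps_minus)
qed

section \<open>Ideals, regular sequences and jets\<close>

lemma ord_ge_cps_ideal: "cps_ideal m (ord_ge m n)"
  unfolding cps_ideal_def by (auto intro: ord_ge_add ord_ge_mult_left ord_ge_conv)

lemma max_ideal_eq: "max_ideal m = coeff ` ord_ge m 1"
proof -
  have "coeff f 0 = 0 \<longleftrightarrow> (\<forall>\<alpha>. deg m \<alpha> < 1 \<longrightarrow> coeff f \<alpha> = 0)" if "conv m f" for f :: "'a mps"
    using deg_zero_imp conv_supp[OF that] by (metis deg_zero less_one)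
  then show ?thesis
    unfolding max_ideal_def cps_carrier by (auto simp: ord_ge_def)
qed

text \<open>That every series of order \<open>n + 1\<close> is in the product of the maximal ideal with its \<open>n\<close>-th power is the
  decomposition along the variables.\<close>

lemma ideal_power_eq: "ideal_power (cps m) (max_ideal m) n = coeff ` ord_ge m n"
proof (induction n)
  case 0
  then show ?case by (simp add: cps_carrier)
next
  case (Suc n)
  let ?P = "ideal_prod (cps m) (coeff ` ord_ge m 1) (coeff ` ord_ge m n) :: 'a pseries set"
  have "?P \<subseteq> coeff ` ord_ge m (Suc n)"
  proof
    fix x assume "x \<in> ?P"
    then show "x \<in> coeff ` ord_ge m (Suc n)"
    proof (induction rule: ideal_prod.induct)
      case (prod i j)
      then show ?case using ord_ge_mult[of _ m 1 _ n] by auto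
    next
      case (sum s1 s2)
      then show ?case using ord_ge_add[of _ m "Suc n"] by (auto simp del: coeff_add)
    qed
  qed
  moreover have "coeff f \<in> ?P" if f: "f \<in> ord_ge m (Suc n)" for f
  proof -
    obtain q where q: "\<forall>i. q i \<in> ord_ge m n" "f = (\<Sum>i<m. q i * var i)"
      using ord_ge_Suc_decompose[OF f] by blast
    have "coeff (\<Sum>i<k. q i * var i) \<in> ?P" if "k \<le> m" for k
      using that
    proof (induction k)
      case 0
      show ?case
        using ideal_prod.prod[of "coeff 0" "coeff ` ord_ge m 1" "coeff 0" "coeff ` ord_ge m n" "cps m"]
        by (auto simp del: coeff_zero coeff_sum)
    next
      case (Suc k)
      have "coeff (q k * var k) \<in> ?P"
        unfolding mult.commute[of "q k"] cps_mult[symmetric, where m = m]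
        using Suc.prems q(1) var_ord_ge[of k m] by (intro ideal_prod.prod) auto
      moreover have "coeff (\<Sum>i<k. q i * var i) \<in> ?P"
        using Suc by (simp only: Suc_leD)
      ultimately show ?case
        unfolding sum.lessThan_Suc cps_add[symmetric, where m = m] by (rule ideal_prod.sum[rotated])
    qed
    then show ?thesis using q(2) by blast
  qed
  ultimately show ?case using Suc.IH by (auto simp: max_ideal_eq)
qed

lemma jet_eq_iff:
  assumes "conv m f" "conv m g"
  shows "jet m \<mu> (coeff g) = jet m \<mu> (coeff f) \<longleftrightarrow> g - f \<in> ord_ge m (Suc \<mu>)"
  unfolding jet_def ideal_power_eq using coset_eq_iff[OF ord_ge_cps_ideal assms(2,1)] by simp

lemma conv_Mps_nth:
  assumes "set fs \<subseteq> carrier (cps m)" "l < length fs"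
  shows "conv m (Mps (fs ! l))"
proof -
  have "coeff (Mps (fs ! l)) \<in> carrier (cps m)" using assms by auto
  then show ?thesis by (simp only: coeff_in_cps)
qed

lemma Idl_eq:
  assumes fs: "set fs \<subseteq> carrier (cps m :: 'a::{real_normed_field,banach} pseries ring)"
  shows "Idl\<^bsub>cps m\<^esub> (set fs) = coeff ` gen m (length fs) (\<lambda>l. Mps (fs ! l))"
proof -
  interpret R: cring "cps m :: 'a pseries ring" by (rule cps_cring)
  let ?f = "\<lambda>l. Mps (fs ! l)"
  have f: "\<forall>l<length fs. conv m (?f l)"
    using conv_Mps_nth[OF fs] by blast
  note I = gen_ideal[OF f]
  have "set fs \<subseteq> coeff ` gen m (length fs) ?f"
  proof
    fix x assume "x \<in> set fs"
    then obtain j where j: "j < length fs" "x = fs ! j" by (auto simp: in_set_conv_nth)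
    have "(\<Sum>l<length fs. (if l = j then 1 else 0) * ?f l) \<in> gen m (length fs) ?f"
      by (rule genI) auto
    moreover have "(\<Sum>l<length fs. (if l = j then 1 else 0) * ?f l) = ?f j"
    proof -
      have "(\<Sum>l<length fs. (if l = j then 1 else 0) * ?f l) = (\<Sum>l<length fs. if l = j then ?f j else 0)"
        by (rule sum.cong) auto
      then show ?thesis using j by simp
    qed
    ultimately have "?f j \<in> gen m (length fs) ?f" by simp
    then show "x \<in> coeff ` gen m (length fs) ?f" using j by (metis coeff_Mps imageI)
  qed
  then have "Idl\<^bsub>cps m\<^esub> (set fs) \<subseteq> coeff ` gen m (length fs) ?f"
    by (rule R.genideal_minimal[OF cps_ideal_ideal[OF I]])
  moreover have "coeff x \<in> Idl\<^bsub>cps m\<^esub> (set fs)" if x: "x \<in> gen m (length fs) ?f" for x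
  proof -
    interpret J: ideal "Idl\<^bsub>cps m\<^esub> (set fs)" "cps m" by (rule R.genideal_ideal[OF fs])
    obtain c where c: "\<forall>l<length fs. conv m (c l)" "x = (\<Sum>l<length fs. c l * ?f l)"
      using x by (elim genE) (rule that)
    have "coeff (\<Sum>l<n. c l * ?f l) \<in> Idl\<^bsub>cps m\<^esub> (set fs)" if "n \<le> length fs" for n
      using that
    proof (induction n)
      case 0
      then show ?case using J.zero_closed by (simp add: cps_zero del: coeff_zero coeff_sum)
    next
      case (Suc n)
      have "coeff (c n * ?f n) \<in> Idl\<^bsub>cps m\<^esub> (set fs)"
        unfolding cps_mult[symmetric, where m = m] coeff_Mps
        using Suc.prems c(1) R.genideal_self[OF fs] by (intro J.I_l_closed) auto
      moreover have "coeff (\<Sum>l<n. c l * ?f l) \<in> Idl\<^bsub>cps m\<^esub> (set fs)"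
        using Suc by (simp only: Suc_leD)
      ultimately show ?case
        unfolding sum.lessThan_Suc cps_add[symmetric, where m = m] by (rule J.a_closed[rotated])
    qed
    then show ?thesis using c(2) by blast
  qed
  ultimately show ?thesis by blast
qed

lemma non_zerodivisor_quotient_iff:
  assumes I: "cps_ideal m (I :: 'a::{real_normed_field,banach} mps set)" and a: "conv m a"
  shows "non_zerodivisor (cps m Quot (coeff ` I)) (coeff ` I +>\<^bsub>cps m\<^esub> coeff a) \<longleftrightarrow>
           (\<forall>b. conv m b \<longrightarrow> b * a \<in> I \<longrightarrow> b \<in> I)"
proof -
  interpret R: cring "cps m :: 'a pseries ring" by (rule cps_cring)
  interpret I: ideal "coeff ` I" "cps m" by (rule cps_ideal_ideal[OF I])
  let ?c = "\<lambda>b. coeff ` I +>\<^bsub>cps m\<^esub> coeff b"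
  have carr: "carrier (cps m Quot (coeff ` I)) = ?c ` {b. conv m b}"
    by (auto simp: FactRing_def A_RCOSETS_def' cps_carrier)
  have zero: "\<zero>\<^bsub>cps m Quot (coeff ` I)\<^esub> = ?c 0"
  proof -
    have "\<zero>\<^bsub>cps m Quot (coeff ` I)\<^esub> = coeff ` I" by (simp add: FactRing_def)
    then show ?thesis using R.a_coset_add_zero[OF I.a_subset] by (simp add: cps_zero)
  qed
  have mult: "?c a \<otimes>\<^bsub>cps m Quot (coeff ` I)\<^esub> ?c b = ?c (b * a)" if "conv m b" for b
    using I.rcoset_mult_add[of "coeff a" "coeff b"] a that by (simp add: FactRing_def mult.commute)
  have eq0: "?c b = ?c 0 \<longleftrightarrow> b \<in> I" if "conv m b" for b
    using coset_eq_iff[OF I that conv_zero] by simp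
  have "non_zerodivisor (cps m Quot (coeff ` I)) (?c a) \<longleftrightarrow>
      (\<forall>b. conv m b \<longrightarrow> ?c a \<otimes>\<^bsub>cps m Quot (coeff ` I)\<^esub> ?c b = ?c 0 \<longrightarrow> ?c b = ?c 0)"
    using a unfolding non_zerodivisor_def carr zero by blast
  also have "\<dots> \<longleftrightarrow> (\<forall>b. conv m b \<longrightarrow> b * a \<in> I \<longrightarrow> b \<in> I)"
    using a by (simp add: mult eq0 conv_mult)
  finally show ?thesis .
qed

lemma regular_sequence_iff:
  assumes fs: "set fs \<subseteq> carrier (cps m :: 'a::{real_normed_field,banach} pseries ring)"
  shows "regular_sequence (cps m) fs \<longleftrightarrow>
     1 \<notin> gen m (length fs) (\<lambda>l. Mps (fs ! l)) \<and> reg m (length fs) (\<lambda>l. Mps (fs ! l))"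
proof -
  interpret R: cring "cps m :: 'a pseries ring" by (rule cps_cring)
  let ?f = "\<lambda>l. Mps (fs ! l)"
  have f: "conv m (?f l)" if "l < length fs" for l
    by (rule conv_Mps_nth[OF fs that])
  have gen_take: "gen m (length (take i fs)) (\<lambda>l. Mps (take i fs ! l)) = gen m i ?f" if "i \<le> length fs" for i
    unfolding gen_def using that by simp
  have proper: "Idl\<^bsub>cps m\<^esub> (set fs) \<noteq> carrier (cps m) \<longleftrightarrow> 1 \<notin> gen m (length fs) ?f"
  proof -
    interpret J: ideal "Idl\<^bsub>cps m\<^esub> (set fs)" "cps m" by (rule R.genideal_ideal[OF fs])
    have "Idl\<^bsub>cps m\<^esub> (set fs) = carrier (cps m) \<longleftrightarrow> coeff 1 \<in> Idl\<^bsub>cps m\<^esub> (set fs)"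
    proof
      assume "Idl\<^bsub>cps m\<^esub> (set fs) = carrier (cps m)"
      then show "coeff 1 \<in> Idl\<^bsub>cps m\<^esub> (set fs)" by (simp only: coeff_in_cps conv_one)
    next
      assume "coeff 1 \<in> Idl\<^bsub>cps m\<^esub> (set fs)"
      then show "Idl\<^bsub>cps m\<^esub> (set fs) = carrier (cps m)"
        using J.one_imp_carrier unfolding cps_one by blast
    qed
    then show ?thesis
      unfolding Idl_eq[OF fs] by simp
  qed
  have first: "non_zerodivisor (cps m) (fs ! 0) \<longleftrightarrow> (\<forall>b. conv m b \<longrightarrow> b * ?f 0 \<in> gen m 0 ?f \<longrightarrow> b \<in> gen m 0 ?f)"
    if "fs \<noteq> []"
  proof -
    have "fs ! 0 \<in> carrier (cps m)" using fs that by auto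
    then have "non_zerodivisor (cps m) (fs ! 0) \<longleftrightarrow>
        (\<forall>b\<in>{b. conv m b}. coeff (?f 0) \<otimes>\<^bsub>cps m\<^esub> coeff b = coeff 0 \<longrightarrow> coeff b = coeff 0)"
      unfolding non_zerodivisor_def cps_zero by (simp add: cps_carrier)
    then show ?thesis by (simp only: cps_mult coeff_inject) (simp add: gen_def mult.commute)
  qed
  have later: "non_zerodivisor (cps m Quot (Idl\<^bsub>cps m\<^esub> (set (take i fs))))
          (Idl\<^bsub>cps m\<^esub> (set (take i fs)) +>\<^bsub>cps m\<^esub> (fs ! i))
      \<longleftrightarrow> (\<forall>b. conv m b \<longrightarrow> b * ?f i \<in> gen m i ?f \<longrightarrow> b \<in> gen m i ?f)" if "i < length fs" for i
  proof -
    have "set (take i fs) \<subseteq> carrier (cps m)" using fs set_take_subset[of i fs] by blast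
    then have "Idl\<^bsub>cps m\<^esub> (set (take i fs)) = coeff ` gen m i ?f"
      using Idl_eq[of "take i fs" m] gen_take[of i] that by simp
    moreover have "cps_ideal m (gen m i ?f)" using f that by (intro gen_ideal) auto
    ultimately show ?thesis
      using non_zerodivisor_quotient_iff[of m "gen m i ?f" "?f i"] f[OF that] by simp
  qed
  let ?P = "\<lambda>i. \<forall>b. conv m b \<longrightarrow> b * ?f i \<in> gen m i ?f \<longrightarrow> b \<in> gen m i ?f"
  have "regular_sequence (cps m) fs \<longleftrightarrow> 1 \<notin> gen m (length fs) ?f \<and>
      (fs \<noteq> [] \<longrightarrow> ?P 0) \<and> (\<forall>i. 0 < i \<and> i < length fs \<longrightarrow> ?P i)"
  proof -
    have later': "(\<forall>i. 0 < i \<and> i < length fs \<longrightarrow>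
        non_zerodivisor (cps m Quot (Idl\<^bsub>cps m\<^esub> (set (take i fs))))
          (Idl\<^bsub>cps m\<^esub> (set (take i fs)) +>\<^bsub>cps m\<^esub> (fs ! i))) \<longleftrightarrow>
        (\<forall>i. 0 < i \<and> i < length fs \<longrightarrow> ?P i)"
      by (rule all_cong1) (rule imp_cong[OF refl], erule conjE, rule later)
    have first': "(fs \<noteq> [] \<longrightarrow> non_zerodivisor (cps m) (fs ! 0)) \<longleftrightarrow> (fs \<noteq> [] \<longrightarrow> ?P 0)"
      by (rule imp_cong[OF refl]) (rule first)
    show ?thesis
      unfolding regular_sequence_def proper later' first' by (simp only: fs simp_thms)
  qed
  moreover have "(fs \<noteq> [] \<longrightarrow> ?P 0) \<and> (\<forall>i. 0 < i \<and> i < length fs \<longrightarrow> ?P i) \<longleftrightarrow> (\<forall>i<length fs. ?P i)"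
    (is "?L \<longleftrightarrow> ?R")
  proof
    assume L: ?L
    show ?R
    proof (intro allI impI)
      fix i b assume "i < length fs" "conv m b" "b * ?f i \<in> gen m i ?f"
      then show "b \<in> gen m i ?f" using L by (cases "i = 0") auto
    qed
  qed auto
  ultimately show ?thesis unfolding reg_def by simp
qed

section \<open>The Hilbert-Samuel function\<close>

definition standard_exponents :: "nat \<Rightarrow> 'a::real_normed_field mps set \<Rightarrow> nat \<Rightarrow> (nat \<Rightarrow>\<^sub>0 nat) set" where
  "standard_exponents m I \<eta> = {\<alpha> \<in> multi_indices m. deg m \<alpha> \<le> \<eta> \<and> \<not> (\<exists>f\<in>I. leads m f \<alpha>)}"

lemma finite_standard_exponents: "finite (standard_exponents m I \<eta>)"
  by (rule finite_subset[OF _ finite_deg_le[of m \<eta>]]) (auto simp: standard_exponents_def)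

lemma coeff_sum_monom:
  "finite S \<Longrightarrow> coeff (\<Sum>\<alpha>\<in>S. monom \<alpha> (c \<alpha>)) \<beta> = (if \<beta> \<in> S then c \<beta> else 0)"
  by simp

lemma conv_sum_monom: "S \<subseteq> multi_indices m \<Longrightarrow> conv m (\<Sum>\<alpha>\<in>S. monom \<alpha> (c \<alpha>))"
  by (rule conv_sum) (auto intro: conv_monom)

text \<open>The leading exponent of a non-zero combination has degree at most \<open>\<eta>\<close>, so it would also be the leading
  exponent of the element \<open>x\<close> of the ideal.\<close>

lemma standard_monomials_independent:
  fixes I :: "'a::real_normed_field mps set"
  assumes I: "cps_ideal m I" and x: "x \<in> I"
    and S: "S \<subseteq> standard_exponents m I \<eta>"
    and r: "(\<Sum>\<alpha>\<in>S. monom \<alpha> (c \<alpha>)) - x \<in> ord_ge m (Suc \<eta>)" and \<alpha>: "\<alpha> \<in> S"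
  shows "c \<alpha> = 0"
proof (rule ccontr)
  assume "c \<alpha> \<noteq> 0"
  let ?p = "\<Sum>\<alpha>\<in>S. monom \<alpha> (c \<alpha>)"
  have fin: "finite S" using S finite_standard_exponents finite_subset by blast
  have p: "conv m ?p" using S by (intro conv_sum_monom) (auto simp: standard_exponents_def)
  have cp: "coeff ?p \<beta> = (if \<beta> \<in> S then c \<beta> else 0)" for \<beta> by (rule coeff_sum_monom[OF fin])
  have "?p \<noteq> 0" using cp[of \<alpha>] \<alpha> \<open>c \<alpha> \<noteq> 0\<close> by (metis coeff_zero)
  then obtain \<beta> where \<beta>: "leads m ?p \<beta>" using leads_exists[OF p] by blast
  then have "\<beta> \<in> S" using cp[of \<beta>] unfolding leads_def by metis
  then have \<beta>S: "deg m \<beta> \<le> \<eta>" "\<not> (\<exists>f\<in>I. leads m f \<beta>)" using S by (auto simp: standard_exponents_def)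
  have "leads m x \<beta>"
    by (rule leads_cong[OF \<beta> ord_ge_antimono[OF r]]) (use \<beta>S in simp)
  then show False using \<beta>S x by blast
qed

text \<open>In the remainder of a division by a standard basis all exponents are standard, and its terms of
  degree at most \<open>\<eta>\<close> are the combination.\<close>

lemma standard_monomials_span:
  fixes I :: "'a::real_normed_field mps set"
  assumes I: "cps_ideal m I" and f: "conv m f"
  shows "\<exists>c. \<exists>x\<in>I. f - (\<Sum>\<alpha>\<in>standard_exponents m I \<eta>. monom \<alpha> (c \<alpha>)) - x \<in> ord_ge m (Suc \<eta>)"
proof -
  let ?S = "standard_exponents m I \<eta>"
  obtain n :: nat and h a where h: "\<forall>j<n. h j \<in> I \<and> leads m (h j) (a j) \<and> coeff (h j) (a j) = 1"
    and gen: "\<forall>f\<in>I. \<forall>\<alpha>. leads m f \<alpha> \<longrightarrow> (\<exists>j<n. \<exists>\<gamma>. \<alpha> = a j + \<gamma>)"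
    using standard_basis_exists[OF I] by (elim exE conjE) (rule that)
  have "\<forall>j<n. conv m (h j) \<and> leads m (h j) (a j) \<and> coeff (h j) (a j) = 1"
    using h cps_ideal_conv[OF I] by blast
  from division[OF this f]
  obtain q r where q: "\<forall>j. conv m (q j)" and r: "conv m r" and eq: "f = (\<Sum>j<n. q j * h j) + r"
    and r0: "\<forall>j<n. \<forall>\<gamma>. coeff r (a j + \<gamma>) = 0"
    by (elim exE conjE) (rule that)
  have "(\<Sum>j<n. q j * h j) \<in> I"
    using q h by (intro cps_ideal_sum[OF I] cps_ideal_mult[OF I]) auto
  moreover have "r - (\<Sum>\<alpha>\<in>?S. monom \<alpha> (coeff r \<alpha>)) \<in> ord_ge m (Suc \<eta>)"
    unfolding ord_ge_def
  proof (intro CollectI conjI allI impI)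
    show "conv m (r - (\<Sum>\<alpha>\<in>?S. monom \<alpha> (coeff r \<alpha>)))"
      by (intro conv_diff r conv_sum_monom) (auto simp: standard_exponents_def)
    fix \<beta> assume "deg m \<beta> < Suc \<eta>"
    have "coeff r \<beta> = 0" if \<beta>: "\<beta> \<notin> ?S"
    proof (cases "\<beta> \<in> multi_indices m")
      case True
      then obtain g where "g \<in> I" "leads m g \<beta>"
        using \<beta> \<open>deg m \<beta> < Suc \<eta>\<close> by (auto simp: standard_exponents_def)
      then show ?thesis using gen r0 by blast
    next
      case False
      then show ?thesis by (rule conv_supp[OF r])
    qed
    then show "coeff (r - (\<Sum>\<alpha>\<in>?S. monom \<alpha> (coeff r \<alpha>))) \<beta> = 0"
      unfolding coeff_diff coeff_sum_monom[OF finite_standard_exponents] by simp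
  qed
  moreover have "f - (\<Sum>\<alpha>\<in>?S. monom \<alpha> (coeff r \<alpha>)) - (\<Sum>j<n. q j * h j) = r - (\<Sum>\<alpha>\<in>?S. monom \<alpha> (coeff r \<alpha>))"
    by (simp add: eq)
  ultimately show ?thesis by metis
qed

lemma const_pseries_eq: "const_pseries c = coeff (monom 0 c)"
  by (auto simp: const_pseries_def)

lemma constants_subfield:
  "subfield (range (\<lambda>c. coeff (monom 0 c))) (cps m :: 'a::{real_normed_field,banach} pseries ring)"
proof -
  interpret R: cring "cps m :: 'a pseries ring" by (rule cps_cring)
  let ?K = "range (\<lambda>c. coeff (monom 0 c)) :: 'a pseries set"
  have conv: "conv m (monom 0 c :: 'a mps)" for c by (rule conv_monom) simp
  have mult: "monom 0 c * monom 0 d = monom 0 (c * d)" for c d :: 'a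
    by (rule mps_eqI) simp
  have add: "monom 0 c + monom 0 d = monom 0 (c + d)" for c d :: 'a
    by (rule mps_eqI) simp
  have neg: "- monom 0 c = monom 0 (- c)" for c :: 'a
    by (rule mps_eqI) simp
  have one: "\<one>\<^bsub>cps m\<^esub> = coeff (monom 0 (1 :: 'a))" by (simp add: cps_one monom_0_1)
  have zero: "\<zero>\<^bsub>cps m\<^esub> = coeff (monom 0 (0 :: 'a))"
    unfolding cps_zero coeff_inject by (rule mps_eqI) simp
  have inj: "coeff (monom 0 c) = coeff (monom 0 d) \<longleftrightarrow> c = d" for c d :: 'a
    by (metis coeff_monom)
  show ?thesis
  proof (rule R.subfieldI)
    show "subcring ?K (cps m)"
    proof (rule R.subcringI'[OF R.subringI])
      show "?K \<subseteq> carrier (cps m)" using conv by auto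
      show "\<one>\<^bsub>cps m\<^esub> \<in> ?K" unfolding one by blast
      fix x y assume "x \<in> ?K" "y \<in> ?K"
      then obtain c d where cd: "x = coeff (monom 0 c)" "y = coeff (monom 0 d)" by blast
      show "\<ominus>\<^bsub>cps m\<^esub> x \<in> ?K" unfolding cd cps_uminus[OF conv] neg by blast
      show "x \<otimes>\<^bsub>cps m\<^esub> y \<in> ?K" unfolding cd cps_mult mult by blast
      show "x \<oplus>\<^bsub>cps m\<^esub> y \<in> ?K" unfolding cd cps_add add by blast
    qed
    have "coeff (monom 0 c) \<in> Units (cps m\<lparr>carrier := ?K\<rparr>) \<longleftrightarrow> c \<noteq> 0" for c :: 'a
    proof -
      have "coeff (monom 0 c) \<in> Units (cps m\<lparr>carrier := ?K\<rparr>) \<longleftrightarrow> (\<exists>d. d * c = 1 \<and> c * d = 1)"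
        unfolding Units_def by (auto simp: one mult inj)
      also have "\<dots> \<longleftrightarrow> c \<noteq> 0"
        by (metis mult_zero_left zero_neq_one left_inverse right_inverse mult_zero_right)
      finally show ?thesis .
    qed
    moreover have "Units (cps m\<lparr>carrier := ?K\<rparr>) \<subseteq> ?K" by (auto simp: Units_def)
    ultimately show "Units (cps m\<lparr>carrier := ?K\<rparr>) = ?K - {\<zero>\<^bsub>cps m\<^esub>}"
      unfolding zero using inj by auto
  qed
qed

text \<open>The classes of the standard monomials form a basis. Properness of the ideal makes the quotient
  non-zero, so that the classes of the constants form a field.\<close>

lemma hilbert_samuel_eq_card:
  fixes I :: "'a::{real_normed_field,banach} mps set"
  assumes I: "cps_ideal m I" and proper: "1 \<notin> I"
  shows "hilbert_samuel m (coeff ` I) \<eta> = card (standard_exponents m I \<eta>)"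
proof -
  interpret R: cring "cps m :: 'a pseries ring" by (rule cps_cring)
  let ?S = "standard_exponents m I \<eta>"
  define L where "L = {x + r | x r. x \<in> I \<and> r \<in> ord_ge m (Suc \<eta>)}"
  have L: "cps_ideal m L"
    unfolding cps_ideal_def
  proof (intro conjI ballI allI impI)
    show "L \<subseteq> {f. conv m f}" using cps_ideal_conv[OF I] ord_ge_conv by (auto simp: L_def intro!: conv_add)
    have "0 \<in> I" using I by (simp add: cps_ideal_def)
    then show "0 \<in> L" unfolding L_def by (intro CollectI exI[of _ 0]) simp
    fix f g :: "'a mps" assume f: "f \<in> L"
    then obtain x r where xr: "x \<in> I" "r \<in> ord_ge m (Suc \<eta>)" "f = x + r" by (auto simp: L_def)
    {
      assume "g \<in> L"
      then obtain y s where "y \<in> I" "s \<in> ord_ge m (Suc \<eta>)" "g = y + s" by (auto simp: L_def)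
      then have "f + g = (x + y) + (r + s)" "x + y \<in> I" "r + s \<in> ord_ge m (Suc \<eta>)"
        using xr by (auto intro: cps_ideal_add[OF I] ord_ge_add)
      then show "f + g \<in> L" unfolding L_def by blast
    next
      assume "conv m g"
      then have "g * f = g * x + g * r" "g * x \<in> I" "g * r \<in> ord_ge m (Suc \<eta>)"
        using xr by (auto simp: distrib_left intro: cps_ideal_mult[OF I] ord_ge_mult_left)
      then show "g * f \<in> L" unfolding L_def by blast
    }
  qed
  have L_eq: "coeff ` I <+>\<^bsub>cps m\<^esub> ideal_power (cps m) (max_ideal m) (\<eta> + 1) = coeff ` L"
    unfolding ideal_power_eq set_add_def' L_def by (auto simp: image_iff)
  have "1 \<notin> L"
  proof
    assume "1 \<in> L"
    then obtain x r where x: "x \<in> I" "r \<in> ord_ge m (Suc \<eta>)" "1 = x + r" by (auto simp: L_def)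
    have "coeff x 0 = 1"
    proof -
      have "coeff (1 :: 'a mps) 0 = 1" using coeff_monom[of 0 1 0] by (simp add: monom_0_1)
      moreover have "coeff r 0 = 0" using x(2) by (simp add: ord_ge_def)
      ultimately show ?thesis using x(3) by (metis add.right_neutral coeff_add)
    qed
    then obtain g where "conv m g" "g * x = 1"
      using unit_if_const_term cps_ideal_conv[OF I x(1)] by (metis zero_neq_one)
    then show False using cps_ideal_mult[OF I x(1)] proper by metis
  qed
  interpret L: ideal "coeff ` L" "cps m" by (rule cps_ideal_ideal[OF L])
  define Q where "Q = cps m Quot (coeff ` L)"
  define cl where "cl f = coeff ` L +>\<^bsub>cps m\<^esub> coeff f" for f
  interpret Q: ring Q unfolding Q_def by (rule L.quotient_is_ring)
  have cl_eq: "cl f = cl g \<longleftrightarrow> f - g \<in> L" if "conv m f" "conv m g" for f g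
    unfolding cl_def by (rule coset_eq_iff[OF L that])
  have carr: "carrier Q = cl ` {f. conv m f}"
    by (auto simp: Q_def cl_def FactRing_def A_RCOSETS_def' cps_carrier)
  have cl_add: "cl f \<oplus>\<^bsub>Q\<^esub> cl g = cl (f + g)" if "conv m f" "conv m g" for f g
    using that L.a_rcos_sum[of "coeff f" "coeff g"] by (simp add: Q_def cl_def FactRing_def)
  have cl_mult: "cl f \<otimes>\<^bsub>Q\<^esub> cl g = cl (f * g)" if "conv m f" "conv m g" for f g
    using that L.rcoset_mult_add[of "coeff f" "coeff g"] by (simp add: Q_def cl_def FactRing_def)
  have cl_zero: "\<zero>\<^bsub>Q\<^esub> = cl 0"
    using R.a_coset_add_zero[OF L.a_subset] by (simp add: Q_def cl_def FactRing_def cps_zero)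
  have cl_one: "\<one>\<^bsub>Q\<^esub> = cl 1"
    by (simp add: Q_def cl_def FactRing_def cps_one)
  define K where "K = range (\<lambda>c :: 'a. cl (monom 0 c))"
  have conv_const: "conv m (monom 0 c :: 'a mps)" for c by (rule conv_monom) simp
  have K_sub: "subfield K Q"
  proof -
    interpret h: ring_hom_ring "cps m" Q "(+>\<^bsub>cps m\<^esub>) (coeff ` L)"
      unfolding Q_def by (rule L.rcos_ring_hom_ring)
    have "\<one>\<^bsub>Q\<^esub> \<noteq> \<zero>\<^bsub>Q\<^esub>" unfolding cl_one cl_zero using cl_eq[of 1 0] \<open>1 \<notin> L\<close> by simp
    then have "subfield ((+>\<^bsub>cps m\<^esub>) (coeff ` L) ` range (\<lambda>c :: 'a. coeff (monom 0 c))) Q"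
      by (rule h.img_is_subfield(2)[OF constants_subfield])
    then show ?thesis by (simp add: K_def cl_def image_image)
  qed
  define M where "M \<alpha> = cl (monom \<alpha> (1 :: 'a))" for \<alpha>
  have Smi: "?S \<subseteq> multi_indices m" by (auto simp: standard_exponents_def)
  have monom_mult: "monom 0 c * monom \<alpha> 1 = monom \<alpha> (c :: 'a)" for c \<alpha>
    by (rule mps_eqI) simp
  have span: "Q.Span K (map M xs) = {cl (\<Sum>\<alpha>\<in>set xs. monom \<alpha> (c \<alpha>)) | c. True}"
    if "distinct xs" "set xs \<subseteq> ?S" for xs
    using that
  proof (induction xs)
    case Nil
    then show ?case by (simp add: cl_zero)
  next
    case (Cons \<alpha> xs)
    have \<alpha>: "\<alpha> \<in> multi_indices m" "\<alpha> \<notin> set xs" "set xs \<subseteq> multi_indices m" using Cons.prems Smi by auto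
    have "Q.Span K (map M (\<alpha> # xs)) = {k \<otimes>\<^bsub>Q\<^esub> M \<alpha> \<oplus>\<^bsub>Q\<^esub> v | k v. k \<in> K \<and> v \<in> Q.Span K (map M xs)}"
      unfolding set_add_def' by (auto simp: Q.line_extension_def r_coset_def set_add_def')
    also have "\<dots> = {cl (monom \<alpha> d + (\<Sum>\<alpha>\<in>set xs. monom \<alpha> (c \<alpha>))) | d c. True}"
    proof -
      have "cl (monom 0 d) \<otimes>\<^bsub>Q\<^esub> M \<alpha> \<oplus>\<^bsub>Q\<^esub> cl (\<Sum>\<alpha>\<in>set xs. monom \<alpha> (c \<alpha>))
          = cl (monom \<alpha> d + (\<Sum>\<alpha>\<in>set xs. monom \<alpha> (c \<alpha>)))" for d c
        unfolding M_def using \<alpha> conv_const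
        by (simp add: cl_mult cl_add conv_monom conv_sum_monom monom_mult)
      then show ?thesis
        using Cons unfolding K_def by (auto simp: image_iff) metis+
    qed
    also have "\<dots> = {cl (\<Sum>\<beta>\<in>set (\<alpha> # xs). monom \<beta> (c \<beta>)) | c. True}"
    proof (intro equalityI subsetI)
      fix z assume "z \<in> {cl (monom \<alpha> d + (\<Sum>\<alpha>\<in>set xs. monom \<alpha> (c \<alpha>))) | d c. True}"
      then obtain d c where z: "z = cl (monom \<alpha> d + (\<Sum>\<alpha>\<in>set xs. monom \<alpha> (c \<alpha>)))" by blast
      have "(\<Sum>\<beta>\<in>set xs. monom \<beta> ((c(\<alpha> := d)) \<beta>)) = (\<Sum>\<beta>\<in>set xs. monom \<beta> (c \<beta>))"
        using \<alpha>(2) by (intro sum.cong) auto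
      then have "z = cl (\<Sum>\<beta>\<in>set (\<alpha> # xs). monom \<beta> ((c(\<alpha> := d)) \<beta>))"
        using \<alpha>(2) z by simp
      then show "z \<in> {cl (\<Sum>\<beta>\<in>set (\<alpha> # xs). monom \<beta> (c \<beta>)) | c. True}" by blast
    next
      fix z assume "z \<in> {cl (\<Sum>\<beta>\<in>set (\<alpha> # xs). monom \<beta> (c \<beta>)) | c. True}"
      then show "z \<in> {cl (monom \<alpha> d + (\<Sum>\<alpha>\<in>set xs. monom \<alpha> (c \<alpha>))) | d c. True}"
        using \<alpha>(2) by auto
    qed
    finally show ?case .
  qed
  have indep: "Q.independent K (map M xs)" if "distinct xs" "set xs \<subseteq> ?S" for xs
    using that
  proof (induction xs)
    case Nil
    then show ?case by simp
  next
    case (Cons \<alpha> xs)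
    have \<alpha>: "\<alpha> \<in> multi_indices m" "\<alpha> \<notin> set xs" "set xs \<subseteq> multi_indices m" using Cons.prems Smi by auto
    have "M \<alpha> \<notin> Q.Span K (map M xs)"
    proof
      assume "M \<alpha> \<in> Q.Span K (map M xs)"
      then obtain c where c: "M \<alpha> = cl (\<Sum>\<beta>\<in>set xs. monom \<beta> (c \<beta>))"
        using span[of xs] Cons.prems by auto
      then have "monom \<alpha> 1 - (\<Sum>\<beta>\<in>set xs. monom \<beta> (c \<beta>)) \<in> L"
        unfolding M_def using \<alpha> by (subst (asm) cl_eq) (auto intro: conv_monom conv_sum_monom)
      moreover have "monom \<alpha> 1 - (\<Sum>\<beta>\<in>set xs. monom \<beta> (c \<beta>))
          = (\<Sum>\<beta>\<in>set (\<alpha> # xs). monom \<beta> (if \<beta> = \<alpha> then 1 else - c \<beta>))" (is "_ = ?p")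
        using \<alpha>(2) by (intro mps_eqI) (auto simp: sum_negf)
      ultimately obtain x r where x: "x \<in> I" "r \<in> ord_ge m (Suc \<eta>)" "?p = x + r"
        by (auto simp: L_def)
      then have "?p - x \<in> ord_ge m (Suc \<eta>)" by simp
      from standard_monomials_independent[OF I x(1) Cons.prems(2) this, of \<alpha>] show False by simp
    qed
    moreover have "M \<alpha> \<in> carrier Q" using \<alpha> by (auto simp: M_def carr conv_monom)
    moreover have "Q.independent K (map M xs)" using Cons by simp
    ultimately show ?case unfolding list.map by (intro Q.li_Cons)
  qed
  obtain xs where xs: "set xs = ?S" "distinct xs"
    using finite_distinct_list[OF finite_standard_exponents] by blast
  have "Q.Span K (map M xs) = carrier Q"
  proof
    show "Q.Span K (map M xs) \<subseteq> carrier Q"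
      using span[OF xs(2)] xs(1) Smi by (auto simp: carr intro!: imageI conv_sum_monom)
    show "carrier Q \<subseteq> Q.Span K (map M xs)"
    proof
      fix z assume "z \<in> carrier Q"
      then obtain f where f: "conv m f" "z = cl f" by (auto simp: carr)
      obtain c x where x: "x \<in> I" "f - (\<Sum>\<alpha>\<in>?S. monom \<alpha> (c \<alpha>)) - x \<in> ord_ge m (Suc \<eta>)"
        using standard_monomials_span[OF I f(1)] by blast
      have "f - (\<Sum>\<alpha>\<in>?S. monom \<alpha> (c \<alpha>)) = x + (f - (\<Sum>\<alpha>\<in>?S. monom \<alpha> (c \<alpha>)) - x)" by simp
      then have "f - (\<Sum>\<alpha>\<in>?S. monom \<alpha> (c \<alpha>)) \<in> L" using x unfolding L_def by blast
      then have "z = cl (\<Sum>\<alpha>\<in>?S. monom \<alpha> (c \<alpha>))"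
        using f cl_eq[OF f(1) conv_sum_monom[OF Smi]] by simp
      then show "z \<in> Q.Span K (map M xs)" using span[OF xs(2)] xs(1) by auto
    qed
  qed
  then have "Q.dimension (length xs) K (carrier Q)"
    using Q.dimension_independent[OF indep[OF xs(2)]] xs(1) by simp
  then have "Q.dim K (carrier Q) = length xs"
    using Q.dimI[OF K_sub] by (simp add: over_def)
  moreover have "length xs = card ?S" using xs by (metis distinct_card)
  ultimately show ?thesis
    unfolding hilbert_samuel_def L_eq Let_def const_pseries_eq
    by (simp add: Q_def K_def cl_def)
qed

theorem theorem1p1:
  fixes m k :: nat
    and U :: "(nat \<Rightarrow> 'a::{real_normed_field,banach}) set"
    and \<I> :: "(nat \<Rightarrow> 'a) \<Rightarrow> 'a pseries set"
    and I :: "'a pseries set"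
    and fs :: "'a pseries list"
  assumes "analytic_subspace m U \<I>"
    and "(\<lambda>_. 0) \<in> points m U \<I>"
    and "dim_at m \<I> (\<lambda>_. 0) + enat k = enat m"
    and "I = \<I> (\<lambda>_. 0)"
    and "complete_intersection TYPE('b) (local_ring m \<I> (\<lambda>_. 0))"
    and "length fs = k"
    and "regular_sequence (cps m) fs"
    and "I = Idl\<^bsub>cps m\<^esub> (set fs)"
  shows "\<exists>\<mu>\<^sub>0::nat. \<forall>\<mu>\<ge>\<mu>\<^sub>0. \<forall>gs :: 'a pseries list.
           length gs = k \<and> set gs \<subseteq> carrier (cps m) \<and>
           (\<forall>i<k. jet m \<mu> (gs ! i) = jet m \<mu> (fs ! i)) \<longrightarrow>
             regular_sequence (cps m) gs \<and>
             (\<forall>\<eta>. hilbert_samuel m (Idl\<^bsub>cps m\<^esub> (set gs)) \<eta> = hilbert_samuel m I \<eta>)"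
proof -
  let ?s = "\<lambda>hs :: 'a pseries list. \<lambda>l. Mps (hs ! l)"
  have conv: "\<forall>l<k. conv m (?s hs l)" if "length hs = k" "set hs \<subseteq> carrier (cps m)" for hs
    using that conv_Mps_nth by blast
  have fs: "set fs \<subseteq> carrier (cps m)" using assms(7) by (simp add: regular_sequence_def)
  have f: "1 \<notin> gen m k (?s fs)" "reg m k (?s fs)"
    using regular_sequence_iff[OF fs] assms(6,7) by auto
  note cf = conv[OF assms(6) fs]
  obtain \<mu>\<^sub>0 where \<mu>\<^sub>0: "\<forall>g. same_jets m \<mu>\<^sub>0 k (?s fs) g \<longrightarrow> reg m k g \<and>
       (\<forall>\<alpha>. (\<exists>x\<in>gen m k g. leads m x \<alpha>) \<longleftrightarrow> (\<exists>x\<in>gen m k (?s fs). leads m x \<alpha>))"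
    using leading_exponents_perturbation[OF cf f(2)] by blast
  show ?thesis
  proof (intro exI[of _ \<mu>\<^sub>0] allI impI, elim conjE)
    fix \<mu> and gs :: "'a pseries list"
    assume \<mu>: "\<mu>\<^sub>0 \<le> \<mu>" and gs: "length gs = k" "set gs \<subseteq> carrier (cps m)"
      and jets: "\<forall>i<k. jet m \<mu> (gs ! i) = jet m \<mu> (fs ! i)"
    note cg = conv[OF gs]
    have "same_jets m \<mu> k (?s fs) (?s gs)"
      unfolding same_jets_def using cf cg jets jet_eq_iff[of m "?s fs l" "?s gs l" \<mu> for l] by simp
    then have "same_jets m \<mu>\<^sub>0 k (?s fs) (?s gs)" using \<mu> by (rule same_jets_mono) simp
    then have g: "reg m k (?s gs)"
      and E: "\<And>\<alpha>. (\<exists>x\<in>gen m k (?s gs). leads m x \<alpha>) \<longleftrightarrow> (\<exists>x\<in>gen m k (?s fs). leads m x \<alpha>)"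
      using \<mu>\<^sub>0 by auto
    note If = gen_ideal[OF cf] and Ig = gen_ideal[OF cg]
    have "1 \<notin> gen m k (?s gs)"
    proof
      assume "1 \<in> gen m k (?s gs)"
      moreover have "leads m (1 :: 'a mps) 0"
        unfolding monom_0_1[symmetric] by (auto simp: leads_def)
      ultimately obtain x where x: "x \<in> gen m k (?s fs)" "leads m x 0" using E by blast
      then obtain h where "conv m h" "h * x = 1"
        using unit_if_const_term[OF cps_ideal_conv[OF If x(1)]] by (auto simp: leads_def)
      then show False using cps_ideal_mult[OF If x(1)] f(1) by metis
    qed
    moreover from this have "hilbert_samuel m (Idl\<^bsub>cps m\<^esub> (set gs)) \<eta> = hilbert_samuel m I \<eta>" for \<eta>
      unfolding assms(8) Idl_eq[OF gs(2)] Idl_eq[OF fs] gs(1) assms(6)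
      using hilbert_samuel_eq_card[OF Ig] hilbert_samuel_eq_card[OF If f(1)]
      by (simp add: standard_exponents_def E)
    ultimately show "regular_sequence (cps m) gs \<and>
        (\<forall>\<eta>. hilbert_samuel m (Idl\<^bsub>cps m\<^esub> (set gs)) \<eta> = hilbert_samuel m I \<eta>)"
      using regular_sequence_iff[OF gs(2)] gs(1) g by simp
  qed
qed

end
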